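(* Let $\mathbb{K}$ be a field and let $A=\sigma(\mathbb{K})\langle x_1,\dots,x_n\rangle$ be a constant skew PBW extension of $\mathbb{K}$. Then $A$ is a PBW deformation of its homogeneous version $B$.
   Context: Skew PBW extension. Let $\mathbb{K}$ be a field. A ring $A\supseteq\mathbb{K}$ is a skew PBW extension of $\mathbb{K}$ in the variables $x_1,\dots,x_n\in A$, written $A=\sigma(\mathbb{K})\langle x_1,\dots,x_n\rangle$, if: $A$ is a free left $\mathbb{K}$-module with basis the standard monomials $\{x_1^{\alpha_1}\cdots x_n^{\alpha_n}\mid \alpha\in\mathbb{N}^n\}$; for each $i$ and each $r\in\mathbb{K}\setminus\{0\}$ there is $c_{i,r}\in\mathbb{K}\setminus\{0\}$ with $x_ir-c_{i,r}x_i\in\mathbb{K}$; and for all $1\le i,j\le n$ there is $c_{i,j}\in\mathbb{K}\setminus\{0\}$ with $x_jx_i-c_{i,j}x_ix_j\in\mathbb{K}+\mathbb{K}x_1+\cdots+\mathbb{K}x_n$. $A$ is constant if $x_ir=rx_i$ for all $i$ and all $r\in\mathbb{K}$. PBW deformation. Let $V$ be a $\mathbb{K}$-vector space, $T(V)=\bigoplus_i V^{\otimes i}$ its tensor algebra, $F_i(T)=\bigoplus_{j\le i}V^{\otimes j}$. Let $P\subseteq F_2(T)=\mathbb{K}\oplus V\oplus(V\otimes V)$ be a subspace and $A=T(V)/\langle P\rangle$ (a nonhomogeneous quadratic algebra), where $\langle P\rangle$ is the two-sided ideal generated by $P$. $A$ inherits a filtration from $T(V)$ (the images of the $F_i(T)$),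 with associated graded algebra $Gr(A)$. Let $\pi:F_2(T)\to V\otimes V$ be the projection onto the homogeneous component, and $R=\pi(P)$. The homogeneous quadratic algebra $B=T(V)/\langle R\rangle$ is called the homogeneous version of $A$ (determined by $P$). The projection $T(V)\to A$ induces a natural epimorphism $p:T(V)/\langle R\rangle\to Gr(A)$. $A$ is a PBW deformation of $B$ if $p$ is an isomorphism. Application to skew PBW extensions. For a constant skew PBW extension $A$ of $\mathbb{K}$, $V$ is the vector space with basis $x_1,\dots,x_n$, so $T(V)=\mathbb{K}\langle x_1,\dots,x_n\rangle$, and $P$ is the subspace spanned by the elements $x_jx_i-c_{i,j}x_ix_j+r_0+r_1x_1+\cdots+r_nx_n$ ($1\le i,j\le n$, with $r_0,\dots,r_n\in\mathbb{K}$ depending on $i,j$) that vanish in $A$ by the definition of skew PBW extension; then $A=\mathbb{K}\langle x_1,\dots,x_n\rangle/\langle P\rangle$. Its homogeneous version is $B=\mathbb{K}\langle x_1,\dots,x_n\rangle/\langle x_jx_i-c_{i,j}x_ix_j\mid 1\le i,j\le n\rangle$. *)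

theory Defs
  imports "HOL-Algebra.QuotRing" "HOL-Algebra.Subrings"
begin

section \<open>Skew PBW extensions of a field\<close>

text \<open>
  The family \<open>b\<close>, indexed by \<open>J\<close>, is a basis of the ring \<open>A\<close> as a left module over its
  subring \<open>K\<close>: every element is a (finite) left linear combination of the family in exactly one way.
\<close>

definition left_module_basis ::
  "('a, 'm) ring_scheme \<Rightarrow> 'a set \<Rightarrow> 'j set \<Rightarrow> ('j \<Rightarrow> 'a) \<Rightarrow> bool" where
  "left_module_basis A K J b \<longleftrightarrow>
     b \<in> J \<rightarrow> carrier A \<and>
     (\<forall>a\<in>carrier A. \<exists>!f. f \<in> J \<rightarrow>\<^sub>E K \<and> finite {\<alpha>\<in>J. f \<alpha> \<noteq> \<zero>\<^bsub>A\<^esub>} \<and>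
        a = (\<Oplus>\<^bsub>A\<^esub>\<alpha>\<in>{\<alpha>\<in>J. f \<alpha> \<noteq> \<zero>\<^bsub>A\<^esub>}. f \<alpha> \<otimes>\<^bsub>A\<^esub> b \<alpha>))"

text \<open>The ordered product of a list of ring elements.\<close>

definition list_product :: "('a, 'm) ring_scheme \<Rightarrow> 'a list \<Rightarrow> 'a" where
  "list_product A as = foldr (\<lambda>a b. a \<otimes>\<^bsub>A\<^esub> b) as \<one>\<^bsub>A\<^esub>"

definition standard_monomial ::
  "('a, 'm) ring_scheme \<Rightarrow> nat \<Rightarrow> (nat \<Rightarrow> 'a) \<Rightarrow> (nat \<Rightarrow> nat) \<Rightarrow> 'a" where
  "standard_monomial A n x \<alpha> = list_product A (map (\<lambda>i. x i [^]\<^bsub>A\<^esub> \<alpha> i) [1..<Suc n])"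

text \<open>The set \<open>K + K x\<^sub>1 + \<dots> + K x\<^sub>n\<close>.\<close>

definition linear_part ::
  "('a, 'm) ring_scheme \<Rightarrow> 'a set \<Rightarrow> nat \<Rightarrow> (nat \<Rightarrow> 'a) \<Rightarrow> 'a set" where
  "linear_part A K n x =
     {r 0 \<oplus>\<^bsub>A\<^esub> (\<Oplus>\<^bsub>A\<^esub>k\<in>{1..n}. r k \<otimes>\<^bsub>A\<^esub> x k) | r :: nat \<Rightarrow> 'a. r \<in> {0..n} \<rightarrow> K}"

text \<open>
  The ring \<open>A\<close> is not assumed commutative; \<^const>\<open>subfield\<close> only asks the subring \<open>K\<close> to be a field.
  Multi-indices in \<open>\<nat>\<^sup>n\<close> are extensional functions on \<open>{1..n}\<close>.
\<close>

definition skew_PBW_extension ::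
  "('a, 'm) ring_scheme \<Rightarrow> 'a set \<Rightarrow> nat \<Rightarrow> (nat \<Rightarrow> 'a) \<Rightarrow> bool" where
  "skew_PBW_extension A K n x \<longleftrightarrow>
     ring A \<and> subfield K A \<and> x \<in> {1..n} \<rightarrow> carrier A \<and>
     left_module_basis A K ({1..n} \<rightarrow>\<^sub>E (UNIV :: nat set)) (standard_monomial A n x) \<and>
     (\<forall>i\<in>{1..n}. \<forall>r\<in>K - {\<zero>\<^bsub>A\<^esub>}. \<exists>c\<in>K - {\<zero>\<^bsub>A\<^esub>}.
        (x i \<otimes>\<^bsub>A\<^esub> r) \<ominus>\<^bsub>A\<^esub> (c \<otimes>\<^bsub>A\<^esub> x i) \<in> K) \<and>
     (\<forall>i\<in>{1..n}. \<forall>j\<in>{1..n}. \<exists>c\<in>K - {\<zero>\<^bsub>A\<^esub>}.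
        (x j \<otimes>\<^bsub>A\<^esub> x i) \<ominus>\<^bsub>A\<^esub> (c \<otimes>\<^bsub>A\<^esub> (x i \<otimes>\<^bsub>A\<^esub> x j)) \<in> linear_part A K n x)"

definition constant_extension ::
  "('a, 'm) ring_scheme \<Rightarrow> 'a set \<Rightarrow> nat \<Rightarrow> (nat \<Rightarrow> 'a) \<Rightarrow> bool" where
  "constant_extension A K n x \<longleftrightarrow>
     (\<forall>i\<in>{1..n}. \<forall>r\<in>K. x i \<otimes>\<^bsub>A\<^esub> r = r \<otimes>\<^bsub>A\<^esub> x i)"

text \<open>A choice \<open>c i j\<close> of the constants \<open>c\<^sub>i\<^sub>,\<^sub>j\<close> that exist by the last clause above.\<close>

definition commutation_constants ::
  "('a, 'm) ring_scheme \<Rightarrow> 'a set \<Rightarrow> nat \<Rightarrow> (nat \<Rightarrow> 'a) \<Rightarrow> (nat \<Rightarrow> nat \<Rightarrow> 'a) \<Rightarrow> bool" where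
  "commutation_constants A K n x c \<longleftrightarrow>
     (\<forall>i\<in>{1..n}. \<forall>j\<in>{1..n}. c i j \<in> K - {\<zero>\<^bsub>A\<^esub>} \<and>
        (x j \<otimes>\<^bsub>A\<^esub> x i) \<ominus>\<^bsub>A\<^esub> (c i j \<otimes>\<^bsub>A\<^esub> (x i \<otimes>\<^bsub>A\<^esub> x j)) \<in> linear_part A K n x)"


section \<open>The tensor algebra\<close>

text \<open>
  For a vector space \<open>V\<close> over \<open>k\<close> with basis indexed by \<open>I\<close>, the tensor algebra \<open>T(V)\<close> is the free
  associative algebra on \<open>I\<close>. An element is represented by its coefficient function on words over
  \<open>I\<close>; the word \<open>[i\<^sub>1, \<dots>, i\<^sub>m]\<close> stands for the tensor of the corresponding basis
  vectors, and multiplication is the convolution induced by concatenation of words.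
\<close>

definition free_algebra ::
  "('k, 'm) ring_scheme \<Rightarrow> 'i set \<Rightarrow> ('k, 'i list \<Rightarrow> 'k) module" where
  "free_algebra k I =
     \<lparr>carrier = {f. (\<forall>w. f w \<in> carrier k) \<and> finite {w. f w \<noteq> \<zero>\<^bsub>k\<^esub>} \<and>
                    {w. f w \<noteq> \<zero>\<^bsub>k\<^esub>} \<subseteq> lists I},
      mult = (\<lambda>f g w. \<Oplus>\<^bsub>k\<^esub>m\<in>{..length w}. f (take m w) \<otimes>\<^bsub>k\<^esub> g (drop m w)),
      one = (\<lambda>w. if w = [] then \<one>\<^bsub>k\<^esub> else \<zero>\<^bsub>k\<^esub>),
      zero = (\<lambda>w. \<zero>\<^bsub>k\<^esub>),
      add = (\<lambda>f g w. f w \<oplus>\<^bsub>k\<^esub> g w),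
      smult = (\<lambda>a f w. a \<otimes>\<^bsub>k\<^esub> f w)\<rparr>"

definition free_var :: "('k, 'm) ring_scheme \<Rightarrow> 'i \<Rightarrow> 'i list \<Rightarrow> 'k" where
  "free_var k i = (\<lambda>w. if w = [i] then \<one>\<^bsub>k\<^esub> else \<zero>\<^bsub>k\<^esub>)"

text \<open>The component of \<open>f\<close> in \<open>V\<^sup>\<otimes>\<^sup>d\<close>.\<close>

definition homogeneous_component ::
  "('k, 'm) ring_scheme \<Rightarrow> nat \<Rightarrow> ('i list \<Rightarrow> 'k) \<Rightarrow> 'i list \<Rightarrow> 'k" where
  "homogeneous_component k d f = (\<lambda>w. if length w = d then f w else \<zero>\<^bsub>k\<^esub>)"

definition tensor_filtration ::
  "('k, 'm) ring_scheme \<Rightarrow> 'i set \<Rightarrow> nat \<Rightarrow> ('i list \<Rightarrow> 'k) set" where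
  "tensor_filtration k I d =
     {f \<in> carrier (free_algebra k I). \<forall>w. f w \<noteq> \<zero>\<^bsub>k\<^esub> \<longrightarrow> length w \<le> d}"

definition subspace_generated ::
  "('k, 'm) ring_scheme \<Rightarrow> ('k, 'v, 'n) module_scheme \<Rightarrow> 'v set \<Rightarrow> 'v set" where
  "subspace_generated k M S = \<Inter>{H. submodule H k M \<and> S \<subseteq> H}"


section \<open>The associated graded ring of a filtered ring\<close>

text \<open>The filtration step \<open>F\<^sub>d\<^sub>-\<^sub>1\<close>, with \<open>F\<^sub>-\<^sub>1 = 0\<close>.\<close>

definition previous_step :: "('a, 'm) ring_scheme \<Rightarrow> (nat \<Rightarrow> 'a set) \<Rightarrow> nat \<Rightarrow> 'a set" where
  "previous_step R F d = (if d = 0 then {\<zero>\<^bsub>R\<^esub>} else F (d - 1))"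

text \<open>
  The direct sum of the quotients \<open>F\<^sub>d / F\<^sub>d\<^sub>-\<^sub>1\<close>: an element is a family of
  cosets, almost all of them zero. The product is induced by
  \<open>(a + F\<^sub>i\<^sub>-\<^sub>1) (b + F\<^sub>j\<^sub>-\<^sub>1) = a b + F\<^sub>i\<^sub>+\<^sub>j\<^sub>-\<^sub>1\<close>; as in
  \<^const>\<open>rcoset_mult\<close>, the union ranges over all representatives, which give the same coset.
\<close>

definition associated_graded ::
  "('a, 'm) ring_scheme \<Rightarrow> (nat \<Rightarrow> 'a set) \<Rightarrow> (nat \<Rightarrow> 'a set) ring" where
  "associated_graded R F =
     \<lparr>carrier = {g. (\<forall>d. \<exists>a\<in>F d. g d = previous_step R F d +>\<^bsub>R\<^esub> a) \<and>
                    finite {d. g d \<noteq> previous_step R F d}},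
      mult = (\<lambda>g h d. \<Union>a\<in>(\<Pi> i\<in>{..d}. g i). \<Union>b\<in>(\<Pi> i\<in>{..d}. h i).
                previous_step R F d +>\<^bsub>R\<^esub> (\<Oplus>\<^bsub>R\<^esub>i\<in>{..d}. a i \<otimes>\<^bsub>R\<^esub> b (d - i))),
      one = (\<lambda>d. if d = 0 then previous_step R F 0 +>\<^bsub>R\<^esub> \<one>\<^bsub>R\<^esub> else previous_step R F d),
      zero = previous_step R F,
      add = (\<lambda>g h d. g d <+>\<^bsub>R\<^esub> h d)\<rparr>"


section \<open>PBW deformations\<close>

definition quadratic_algebra ::
  "('k, 'm) ring_scheme \<Rightarrow> 'i set \<Rightarrow> ('i list \<Rightarrow> 'k) set \<Rightarrow> ('i list \<Rightarrow> 'k) set ring" where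
  "quadratic_algebra k I P =
     free_algebra k I Quot genideal (free_algebra k I) P"

definition quotient_class ::
  "('k, 'm) ring_scheme \<Rightarrow> 'i set \<Rightarrow> ('i list \<Rightarrow> 'k) set \<Rightarrow> ('i list \<Rightarrow> 'k) \<Rightarrow> ('i list \<Rightarrow> 'k) set" where
  "quotient_class k I P f =
     genideal (free_algebra k I) P +>\<^bsub>free_algebra k I\<^esub> f"

definition induced_filtration ::
  "('k, 'm) ring_scheme \<Rightarrow> 'i set \<Rightarrow> ('i list \<Rightarrow> 'k) set \<Rightarrow> nat \<Rightarrow> ('i list \<Rightarrow> 'k) set set" where
  "induced_filtration k I P d = quotient_class k I P ` tensor_filtration k I d"

definition graded_quadratic_algebra ::
  "('k, 'm) ring_scheme \<Rightarrow> 'i set \<Rightarrow> ('i list \<Rightarrow> 'k) set \<Rightarrow> (nat \<Rightarrow> ('i list \<Rightarrow> 'k) set set) ring" where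
  "graded_quadratic_algebra k I P =
     associated_graded (quadratic_algebra k I P) (induced_filtration k I P)"

definition homogeneous_version ::
  "('k, 'm) ring_scheme \<Rightarrow> 'i set \<Rightarrow> ('i list \<Rightarrow> 'k) set \<Rightarrow> ('i list \<Rightarrow> 'k) set ring" where
  "homogeneous_version k I P = quadratic_algebra k I (homogeneous_component k 2 ` P)"

text \<open>
  The natural epimorphism \<open>T(V)/\<langle>R\<rangle> \<rightarrow> Gr(A)\<close>: the class of \<open>f\<close>, with homogeneous components
  \<open>f\<^sub>d\<close>, is sent to the family of the classes of \<open>f\<^sub>d + \<langle>P\<rangle>\<close> in \<open>F\<^sub>d(A)/F\<^sub>d\<^sub>-\<^sub>1(A)\<close>.
  The union over all representatives \<open>f\<close> of the argument is a union of equal cosets.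
\<close>

definition natural_epimorphism ::
  "('k, 'm) ring_scheme \<Rightarrow> 'i set \<Rightarrow> ('i list \<Rightarrow> 'k) set \<Rightarrow>
    ('i list \<Rightarrow> 'k) set \<Rightarrow> nat \<Rightarrow> ('i list \<Rightarrow> 'k) set set" where
  "natural_epimorphism k I P X =
     (\<lambda>d. \<Union>f\<in>X. previous_step (quadratic_algebra k I P) (induced_filtration k I P) d
             +>\<^bsub>quadratic_algebra k I P\<^esub> quotient_class k I P (homogeneous_component k d f))"

text \<open>
  That \<open>T(V)/\<langle>P\<rangle>\<close> is a PBW deformation of its homogeneous version. The scalars of both algebras are
  the classes of constants, which the natural epimorphism respects, so an isomorphism of rings here
  is one of algebras.
\<close>

definition PBW_deformation ::
  "('k, 'm) ring_scheme \<Rightarrow> 'i set \<Rightarrow> ('i list \<Rightarrow> 'k) set \<Rightarrow> bool" where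
  "PBW_deformation k I P \<longleftrightarrow>
     submodule P k (free_algebra k I) \<and> P \<subseteq> tensor_filtration k I 2 \<and>
     natural_epimorphism k I P
       \<in> ring_iso (homogeneous_version k I P) (graded_quadratic_algebra k I P)"

text \<open>
  The ring \<open>A \<supseteq> K\<close> with the elements \<open>x i\<close> is the algebra \<open>T(V)/\<langle>P\<rangle>\<close>, with \<open>K\<close> and the
  \<open>x i\<close> corresponding to the scalars and to the basis of \<open>V\<close>.
\<close>

definition presented_by ::
  "('a, 'm) ring_scheme \<Rightarrow> 'a set \<Rightarrow> 'i set \<Rightarrow> ('i \<Rightarrow> 'a) \<Rightarrow> ('i list \<Rightarrow> 'a) set \<Rightarrow> bool" where
  "presented_by A K I x P \<longleftrightarrow>
     (let k = A\<lparr>carrier := K\<rparr>; T = free_algebra k I in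
      \<exists>h \<in> ring_iso (quadratic_algebra k I P) A.
        (\<forall>r\<in>K. h (quotient_class k I P (r \<odot>\<^bsub>T\<^esub> \<one>\<^bsub>T\<^esub>)) = r) \<and>
        (\<forall>i\<in>I. h (quotient_class k I P (free_var k i)) = x i))"


section \<open>The relations of a constant skew PBW extension\<close>

text \<open>The value in \<open>A\<close> of a noncommutative polynomial with coefficients in \<open>K\<close>.\<close>

definition free_value ::
  "('a, 'm) ring_scheme \<Rightarrow> ('i \<Rightarrow> 'a) \<Rightarrow> ('i list \<Rightarrow> 'a) \<Rightarrow> 'a" where
  "free_value A x f =
     (\<Oplus>\<^bsub>A\<^esub>w\<in>{w. f w \<noteq> \<zero>\<^bsub>A\<^esub>}. f w \<otimes>\<^bsub>A\<^esub> list_product A (map x w))"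

text \<open>The element \<open>x\<^sub>j x\<^sub>i - c\<^sub>i\<^sub>,\<^sub>j x\<^sub>i x\<^sub>j\<close> of the free algebra.\<close>

definition homogeneous_relator ::
  "('k, 'm) ring_scheme \<Rightarrow> nat \<Rightarrow> (nat \<Rightarrow> nat \<Rightarrow> 'k) \<Rightarrow> nat \<Rightarrow> nat \<Rightarrow> nat list \<Rightarrow> 'k" where
  "homogeneous_relator k n c i j =
     (let T = free_algebra k {1..n} in
      (free_var k j \<otimes>\<^bsub>T\<^esub> free_var k i) \<ominus>\<^bsub>T\<^esub>
        (c i j \<odot>\<^bsub>T\<^esub> (free_var k i \<otimes>\<^bsub>T\<^esub> free_var k j)))"

definition relator ::
  "('k, 'm) ring_scheme \<Rightarrow> nat \<Rightarrow> (nat \<Rightarrow> nat \<Rightarrow> 'k) \<Rightarrow> nat \<Rightarrow> nat \<Rightarrow> (nat \<Rightarrow> 'k) \<Rightarrow> nat list \<Rightarrow> 'k"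
where
  "relator k n c i j r =
     (let T = free_algebra k {1..n} in
      homogeneous_relator k n c i j \<oplus>\<^bsub>T\<^esub> (r 0 \<odot>\<^bsub>T\<^esub> \<one>\<^bsub>T\<^esub>) \<oplus>\<^bsub>T\<^esub>
        (\<Oplus>\<^bsub>T\<^esub>l\<in>{1..n}. r l \<odot>\<^bsub>T\<^esub> free_var k l))"

definition relation_space ::
  "('a, 'm) ring_scheme \<Rightarrow> 'a set \<Rightarrow> nat \<Rightarrow> (nat \<Rightarrow> 'a) \<Rightarrow> (nat \<Rightarrow> nat \<Rightarrow> 'a) \<Rightarrow>
    (nat list \<Rightarrow> 'a) set" where
  "relation_space A K n x c =
     (let k = A\<lparr>carrier := K\<rparr> in
      subspace_generated k (free_algebra k {1..n})
        {relator k n c i j r | i j r. i \<in> {1..n} \<and> j \<in> {1..n} \<and> r \<in> {0..n} \<rightarrow> K \<and>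
           free_value A x (relator k n c i j r) = \<zero>\<^bsub>A\<^esub>})"

end

(*
  Let I be the ideal generated by P and J the ideal generated by the quadratic components of P. The
  kernel of T(V) -> Gr(T(V)/I) is the ideal G of those f each of whose homogeneous components f_d
  agrees in degree d with an element of I of degree at most d; always J <= G, and the PBW property
  amounts to G <= J. Modulo J every word is a scalar multiple of its sorted rearrangement, and
  because J <= G this can be imitated modulo I by induction on the degree. The sorted words are
  mapped to the standard monomials of A, which are linearly independent, so an element of I
  supported on sorted words vanishes. This gives both that I is the kernel of the evaluation map
  T(V) -> A and that G <= J.
*)
theory Submission
  imports Defs "HOL-Library.Multiset"
begin

section \<open>The free algebra\<close>

text \<open>No overlap of the rewriting rules is examined. Sorting uses the relations for
  \<open>i < j\<close> only to reach some sorted representative; that it is unique, and that the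
  relators for \<open>i = j\<close> and \<open>i > j\<close> are compatible with the others, comes
  from the linear independence of the standard monomials in the given ring. The price is that
  reduction modulo \<open>J\<close> has to be compared with reduction modulo the inhomogeneous
  ideal, where a swap of two letters leaves terms of lower degree. Those terms are not tracked: the
  induction corrects by some element of the ideal with the same top component. Its existence is the
  inclusion of \<open>J\<close> in the leading ideal, which holds because an element of
  \<open>P\<close> lifts its own quadratic part and because leading forms multiply. The graded ring
  is also approached from \<open>T\<close>. Sending \<open>f\<close> to the family of its symbols is
  a surjective ring homomorphism, so the ring axioms of \<open>Gr\<close> are transported along it,
  and the natural epimorphism is the map that the first isomorphism theorem yields once the kernel
  is identified.\<close>

locale free_alg = cring k for k :: "('k, 'm) ring_scheme" (structure) +
  fixes I :: "'i set"
begin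

abbreviation T where "T \<equiv> free_algebra k I"

lemma free_algebra_sel [simp]:
  "one T = (\<lambda>w. if w = [] then \<one> else \<zero>)"
  "zero T = (\<lambda>w. \<zero>)"
  "add T f g = (\<lambda>w. f w \<oplus> g w)"
  "smult T a f = (\<lambda>w. a \<otimes> f w)"
  by (simp_all add: free_algebra_def)

lemma mult_free_algebra:
  "monoid.mult T f g = (\<lambda>w. \<Oplus>m\<in>{..length w}. f (take m w) \<otimes> g (drop m w))"
  by (simp add: free_algebra_def)

lemma carrier_free_algebra_iff:
  "f \<in> carrier T \<longleftrightarrow>
     (\<forall>w. f w \<in> carrier k) \<and> finite {w. f w \<noteq> \<zero>} \<and> {w. f w \<noteq> \<zero>} \<subseteq> lists I"
  by (simp add: free_algebra_def)

lemma coeff_closed [simp, intro]: "f \<in> carrier T \<Longrightarrow> f w \<in> carrier k"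
  by (simp add: carrier_free_algebra_iff)

lemma finite_support: "f \<in> carrier T \<Longrightarrow> finite {w. f w \<noteq> \<zero>}"
  by (simp add: carrier_free_algebra_iff)

lemma coeff_outside: "f \<in> carrier T \<Longrightarrow> w \<notin> lists I \<Longrightarrow> f w = \<zero>"
  by (auto simp: carrier_free_algebra_iff)

lemma support_lists: "f \<in> carrier T \<Longrightarrow> f w \<noteq> \<zero> \<Longrightarrow> w \<in> lists I"
  by (auto simp: carrier_free_algebra_iff)

lemma exists_length_bound:
  assumes "f \<in> carrier T"
  obtains d where "\<And>w. f w \<noteq> \<zero> \<Longrightarrow> length w < d"
proof -
  obtain m where "\<forall>l\<in>length ` {w. f w \<noteq> \<zero>}. l < m"
    using finite_nat_set_iff_bounded[of "length ` {w. f w \<noteq> \<zero>}"] finite_support[OF assms] by blast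
  then show thesis by (intro that) auto
qed

lemma free_algebraI:
  assumes "\<And>w. f w \<in> carrier k" "finite S" "\<And>w. f w \<noteq> \<zero> \<Longrightarrow> w \<in> S"
    "\<And>w. f w \<noteq> \<zero> \<Longrightarrow> w \<in> lists I"
  shows "f \<in> carrier T"
  unfolding carrier_free_algebra_iff
  using assms finite_subset[of "{w. f w \<noteq> \<zero>}" S] by blast

section \<open>Convolution of coefficient functions by recursion on words\<close>

lemma mult_Nil:
  assumes "\<And>w. f w \<in> carrier k" "\<And>w. g w \<in> carrier k"
  shows "monoid.mult T f g [] = f [] \<otimes> g []"
  using assms by (simp add: mult_free_algebra)

text \<open>This recursion lets induction on the word replace the double sums in the proof of associativity.\<close>

lemma mult_Cons:
  assumes "\<And>w. f w \<in> carrier k" "\<And>w. g w \<in> carrier k"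
  shows "monoid.mult T f g (a # w) = f [] \<otimes> g (a # w) \<oplus> monoid.mult T (\<lambda>u. f (a # u)) g w"
  using assms
  by (simp add: mult_free_algebra finsum_Suc2 a_comm del: finsum_Suc)

lemma mult_coeff_closed [simp]:
  assumes "\<And>w. f w \<in> carrier k" "\<And>w. g w \<in> carrier k"
  shows "monoid.mult T f g w \<in> carrier k"
  using assms by (simp add: mult_free_algebra)

text \<open>At each word the convolution is a finite sum over the splittings of that word, so this
  law and the next ones hold for arbitrary coefficient functions with values in \<open>k\<close>.
  They then apply to shifted functions such as \<open>\<lambda>u. f (a # u)\<close> without an
  argument about supports.\<close>

lemma conv_add_left:
  assumes "\<And>w. f w \<in> carrier k" "\<And>w. g w \<in> carrier k" "\<And>w. h w \<in> carrier k"
  shows "monoid.mult T (\<lambda>w. f w \<oplus> g w) h w = monoid.mult T f h w \<oplus> monoid.mult T g h w"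
  using assms by (simp add: mult_free_algebra l_distr finsum_addf)

lemma conv_add_right:
  assumes "\<And>w. f w \<in> carrier k" "\<And>w. g w \<in> carrier k" "\<And>w. h w \<in> carrier k"
  shows "monoid.mult T f (\<lambda>w. g w \<oplus> h w) w = monoid.mult T f g w \<oplus> monoid.mult T f h w"
  using assms by (simp add: mult_free_algebra r_distr finsum_addf)

lemma conv_smult_left:
  assumes "a \<in> carrier k" "\<And>w. f w \<in> carrier k" "\<And>w. g w \<in> carrier k"
  shows "monoid.mult T (\<lambda>w. a \<otimes> f w) g w = a \<otimes> monoid.mult T f g w"
  using assms by (simp add: mult_free_algebra m_assoc finsum_rdistr)

text \<open>Removing the first letter of a word shifts only the left factor and leaves
  \<open>g\<close> and \<open>h\<close> alone, so the induction hypothesis is used for the shifted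
  \<open>f\<close>; hence the generalization.\<close>

lemma conv_assoc:
  assumes "\<And>w. f w \<in> carrier k" "\<And>w. g w \<in> carrier k" "\<And>w. h w \<in> carrier k"
  shows "monoid.mult T (monoid.mult T f g) h w = monoid.mult T f (monoid.mult T g h) w"
  using assms
proof (induction w arbitrary: f g)
  case Nil
  then show ?case by (simp add: mult_Nil m_assoc)
next
  case (Cons a w)
  note [simp] = Cons.prems
  \<comment> \<open>A Leibniz-like rule for removing a first letter from a product; linearity then
    splits the outer product.\<close>
  have shift: "(\<lambda>u. monoid.mult T f g (a # u)) =
      (\<lambda>u. f [] \<otimes> g (a # u) \<oplus> monoid.mult T (\<lambda>v. f (a # v)) g u)"
    by (simp add: mult_Cons)
  have "monoid.mult T (monoid.mult T f g) h (a # w) =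
      f [] \<otimes> g [] \<otimes> h (a # w) \<oplus>
      (f [] \<otimes> monoid.mult T (\<lambda>u. g (a # u)) h w \<oplus> monoid.mult T (monoid.mult T (\<lambda>v. f (a # v)) g) h w)"
    by (simp add: mult_Cons mult_Nil shift conv_add_left conv_smult_left)
  also have "monoid.mult T (monoid.mult T (\<lambda>v. f (a # v)) g) h w = monoid.mult T (\<lambda>v. f (a # v)) (monoid.mult T g h) w"
    by (rule Cons.IH) simp_all
  finally show ?case
    by (simp add: mult_Cons r_distr m_assoc a_assoc)
qed

lemma conv_one_right:
  assumes "\<And>w. f w \<in> carrier k"
  shows "monoid.mult T f (one T) w = f w"
  using assms by (induction w arbitrary: f) (simp_all add: mult_Nil mult_Cons)

lemma conv_zero_left:
  assumes "\<And>w. g w \<in> carrier k"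
  shows "monoid.mult T (\<lambda>w. \<zero>) g w = \<zero>"
  using assms by (simp add: mult_free_algebra)

lemma conv_one_left:
  assumes "\<And>w. f w \<in> carrier k"
  shows "monoid.mult T (one T) f w = f w"
  using assms by (cases w) (simp_all add: mult_Nil mult_Cons conv_zero_left del: free_algebra_sel(2))

lemma mult_nonzeroE:
  assumes "\<And>w. f w \<in> carrier k" "\<And>w. g w \<in> carrier k" "monoid.mult T f g w \<noteq> \<zero>"
  obtains u v where "w = u @ v" "f u \<noteq> \<zero>" "g v \<noteq> \<zero>"
proof -
  have "\<exists>m. f (take m w) \<otimes> g (drop m w) \<noteq> \<zero>"
    using assms(3) unfolding mult_free_algebra by (metis (mono_tags, lifting) add.finprod_one_eqI)
  then obtain m where "f (take m w) \<otimes> g (drop m w) \<noteq> \<zero>" ..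
  then have "f (take m w) \<noteq> \<zero>" "g (drop m w) \<noteq> \<zero>"
    using assms(1,2) by auto
  then show thesis by (rule that[OF append_take_drop_id[symmetric]])
qed

lemma mult_carrier:
  assumes "f \<in> carrier T" "g \<in> carrier T"
  shows "monoid.mult T f g \<in> carrier T"
proof (rule free_algebraI)
  show "finite ((\<lambda>(u, v). u @ v) ` ({w. f w \<noteq> \<zero>} \<times> {w. g w \<noteq> \<zero>}))"
    using assms by (intro finite_imageI finite_cartesian_product finite_support)
  fix w
  show "monoid.mult T f g w \<in> carrier k" using assms by simp
  assume nz: "monoid.mult T f g w \<noteq> \<zero>"
  obtain u v where uv: "w = u @ v" "f u \<noteq> \<zero>" "g v \<noteq> \<zero>"
    by (rule mult_nonzeroE[of f g w]) (use assms nz in auto)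
  then show "w \<in> (\<lambda>(u, v). u @ v) ` ({w. f w \<noteq> \<zero>} \<times> {w. g w \<noteq> \<zero>})"
    by auto
  show "w \<in> lists I" using uv assms coeff_outside
    by (metis append_in_lists_conv)
qed

lemma ring_free_algebra: "ring T"
proof (rule ringI)
  show "abelian_group T"
  proof (rule abelian_groupI)
    fix f g assume fg: "f \<in> carrier T" "g \<in> carrier T"
    show "f \<oplus>\<^bsub>T\<^esub> g \<in> carrier T"
    proof (rule free_algebraI)
      show "finite ({w. f w \<noteq> \<zero>} \<union> {w. g w \<noteq> \<zero>})" using fg by (simp add: finite_support)
      fix w assume "(f \<oplus>\<^bsub>T\<^esub> g) w \<noteq> \<zero>"
      then have nz: "f w \<noteq> \<zero> \<or> g w \<noteq> \<zero>" using fg by auto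
      then show "w \<in> lists I" using fg support_lists by blast
      from nz show "w \<in> {w. f w \<noteq> \<zero>} \<union> {w. g w \<noteq> \<zero>}" by auto
    qed (use fg in simp)
    show "f \<oplus>\<^bsub>T\<^esub> g = g \<oplus>\<^bsub>T\<^esub> f" using fg by (simp add: a_comm)
  next
    show "\<zero>\<^bsub>T\<^esub> \<in> carrier T" by (simp add: carrier_free_algebra_iff)
  next
    fix f assume f: "f \<in> carrier T"
    show "\<zero>\<^bsub>T\<^esub> \<oplus>\<^bsub>T\<^esub> f = f" using f by simp
    have "(\<lambda>w. \<ominus> f w) \<in> carrier T"
    proof (rule free_algebraI)
      show "finite {w. f w \<noteq> \<zero>}" using f by (rule finite_support)
    qed (use f coeff_outside in \<open>auto intro: ccontr\<close>)
    then show "\<exists>g\<in>carrier T. g \<oplus>\<^bsub>T\<^esub> f = \<zero>\<^bsub>T\<^esub>"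
      using f by (intro bexI[of _ "\<lambda>w. \<ominus> f w"]) (simp_all add: l_neg)
  qed (simp add: a_assoc)
  show "monoid T"
  proof (rule monoidI)
    show "\<one>\<^bsub>T\<^esub> \<in> carrier T"
      by (rule free_algebraI[of _ "{[]}"]) (simp_all split: if_splits)
    fix f g h assume "f \<in> carrier T" "g \<in> carrier T" "h \<in> carrier T"
    then show "f \<otimes>\<^bsub>T\<^esub> g \<otimes>\<^bsub>T\<^esub> h = f \<otimes>\<^bsub>T\<^esub> (g \<otimes>\<^bsub>T\<^esub> h)"
      by (intro ext conv_assoc) auto
  qed (use conv_one_left conv_one_right mult_carrier in \<open>auto simp: fun_eq_iff\<close>)
  fix f g h assume "f \<in> carrier T" "g \<in> carrier T" "h \<in> carrier T"
  then show "(f \<oplus>\<^bsub>T\<^esub> g) \<otimes>\<^bsub>T\<^esub> h = f \<otimes>\<^bsub>T\<^esub> h \<oplus>\<^bsub>T\<^esub> g \<otimes>\<^bsub>T\<^esub> h"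
    "h \<otimes>\<^bsub>T\<^esub> (f \<oplus>\<^bsub>T\<^esub> g) = h \<otimes>\<^bsub>T\<^esub> f \<oplus>\<^bsub>T\<^esub> h \<otimes>\<^bsub>T\<^esub> g"
    by (simp_all add: fun_eq_iff conv_add_left conv_add_right)
qed

end

sublocale free_alg \<subseteq> T: ring "free_algebra k I"
  by (rule ring_free_algebra)

context free_alg begin

lemma module_free_algebra: "module k T"
proof (rule moduleI)
  fix a f assume a: "a \<in> carrier k" and f: "f \<in> carrier T"
  show "a \<odot>\<^bsub>T\<^esub> f \<in> carrier T"
  proof (rule free_algebraI)
    show "finite {w. f w \<noteq> \<zero>}" using f by (rule finite_support)
    fix w assume "(a \<odot>\<^bsub>T\<^esub> f) w \<noteq> \<zero>"
    then show nz: "w \<in> {w. f w \<noteq> \<zero>}" using a by auto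
    then show "w \<in> lists I" using f support_lists by blast
  qed (use a f in simp)
qed (auto simp: cring_axioms T.is_abelian_group l_distr r_distr m_assoc fun_eq_iff)

text \<open>Negation in \<open>T\<close> is given by a description over the carrier, so its values
  have to be recovered from the uniqueness of negatives in \<open>k\<close>.\<close>

lemma neg_eq:
  assumes "f \<in> carrier T"
  shows "\<ominus>\<^bsub>T\<^esub> f = (\<lambda>w. \<ominus> f w)"
proof
  fix w
  have "(\<ominus>\<^bsub>T\<^esub> f \<oplus>\<^bsub>T\<^esub> f) w = \<zero>" using assms by (subst T.l_neg) simp_all
  then show "(\<ominus>\<^bsub>T\<^esub> f) w = \<ominus> f w"
    using assms by (simp add: minus_equality[symmetric] coeff_closed[OF T.a_inv_closed])
qed

lemma diff_eq:
  assumes "f \<in> carrier T" "g \<in> carrier T"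
  shows "f \<ominus>\<^bsub>T\<^esub> g = (\<lambda>w. f w \<ominus> g w)"
  using assms by (simp add: a_minus_def neg_eq)

text \<open>\<open>S\<close> may be infinite: both sums then default to zero.\<close>

lemma finsum_coeff:
  assumes "F \<in> S \<rightarrow> carrier T"
  shows "finsum T F S w = (\<Oplus>s\<in>S. F s w)"
  using assms
proof (induction S rule: infinite_finite_induct)
  case (insert s S)
  then have "F \<in> S \<rightarrow> carrier T" "F s \<in> carrier T" by auto
  then show ?case using insert by (simp add: T.finsum_insert finsum_insert Pi_iff)
qed simp_all

section \<open>Monomials and induction over the support\<close>

definition monomial :: "'k \<Rightarrow> 'i list \<Rightarrow> 'i list \<Rightarrow> 'k" where
  "monomial a w = (\<lambda>v. if v = w then a else \<zero>)"

lemma monom_carrier [simp, intro]: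
  "a \<in> carrier k \<Longrightarrow> w \<in> lists I \<Longrightarrow> monomial a w \<in> carrier T"
  by (rule free_algebraI[of _ "{w}"]) (auto simp: monomial_def split: if_splits)

lemma free_var_eq: "free_var k i = monomial \<one> [i]"
  by (simp add: free_var_def monomial_def)

lemma one_eq: "\<one>\<^bsub>T\<^esub> = monomial \<one> []"
  by (simp add: monomial_def)

lemma smult_monom: "a \<in> carrier k \<Longrightarrow> b \<in> carrier k \<Longrightarrow> a \<odot>\<^bsub>T\<^esub> monomial b w = monomial (a \<otimes> b) w"
  by (auto simp: monomial_def)

lemma mult_monom_monom:
  assumes "a \<in> carrier k" "b \<in> carrier k" "u \<in> lists I" "v \<in> lists I"
  shows "monomial a u \<otimes>\<^bsub>T\<^esub> monomial b v = monomial (a \<otimes> b) (u @ v)"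
proof
  fix w
  from assms(1,2) show "(monomial a u \<otimes>\<^bsub>T\<^esub> monomial b v) w = monomial (a \<otimes> b) (u @ v) w"
  proof (induction u arbitrary: w)
    case Nil
    \<comment> \<open>A constant monomial is a scalar multiple of the unit, so linearity reduces the
      claim to the unit law.\<close>
    then have "monomial a [] = (\<lambda>w. a \<otimes> \<one>\<^bsub>T\<^esub> w)" by (auto simp: monomial_def)
    moreover have "monoid.mult T (\<lambda>w. a \<otimes> \<one>\<^bsub>T\<^esub> w) (monomial b v) w = a \<otimes> monomial b v w"
      using Nil T.one_closed by (subst conv_smult_left; simp add: conv_one_left monomial_def del: free_algebra_sel)
    ultimately show ?case using Nil by (simp add: monomial_def)
  next
    case (Cons i u)
    \<comment> \<open>Removing the letter \<open>j\<close> from a monomial either shortens its word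
      or kills it, which matches the recursion of the product.\<close>
    have sh: "(\<lambda>t. monomial a (i # u) (j # t)) = (if i = j then monomial a u else (\<lambda>w. \<zero>))" for j
      by (auto simp: monomial_def)
    show ?case
    proof (cases w)
      case Nil
      with Cons.prems show ?thesis by (subst Nil, subst mult_Nil) (auto simp: monomial_def)
    next
      case (Cons j w')
      have "monoid.mult T (monomial a (i # u)) (monomial b v) w =
         monomial a (i # u) [] \<otimes> monomial b v w \<oplus> monoid.mult T (\<lambda>t. monomial a (i # u) (j # t)) (monomial b v) w'"
        unfolding Cons using \<open>a \<in> carrier k\<close> \<open>b \<in> carrier k\<close> by (intro mult_Cons) (auto simp: monomial_def)
      also have "\<dots> = monoid.mult T (\<lambda>t. monomial a (i # u) (j # t)) (monomial b v) w'"
        using \<open>a \<in> carrier k\<close> \<open>b \<in> carrier k\<close> by (simp add: monomial_def)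
      also have "\<dots> = monomial (a \<otimes> b) ((i # u) @ v) w"
        unfolding sh using Cons Cons.IH[of w'] \<open>a \<in> carrier k\<close> \<open>b \<in> carrier k\<close>
        by (auto simp: conv_zero_left monomial_def)
      finally show ?thesis .
    qed
  qed
qed

text \<open>Scaling is a left multiplication inside the ring; therefore ideals are subspaces and
  ring homomorphisms control scalar multiples.\<close>

lemma smult_eq_mult:
  assumes "a \<in> carrier k" "f \<in> carrier T"
  shows "a \<odot>\<^bsub>T\<^esub> f = monomial a [] \<otimes>\<^bsub>T\<^esub> f"
proof
  fix w
  have "monomial a [] = (\<lambda>w. a \<otimes> \<one>\<^bsub>T\<^esub> w)" using assms by (auto simp: monomial_def)
  moreover have "monoid.mult T (\<lambda>w. a \<otimes> \<one>\<^bsub>T\<^esub> w) f w = a \<otimes> f w"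
    using assms by (subst conv_smult_left; simp add: conv_one_left del: free_algebra_sel)
  ultimately show "(a \<odot>\<^bsub>T\<^esub> f) w = (monomial a [] \<otimes>\<^bsub>T\<^esub> f) w" by simp
qed

text \<open>The step keeps the fact that \<open>w\<close> lies in the support of the original
  \<open>f\<close>, so that a length bound on \<open>f\<close> is available for every monomial
  added.\<close>

lemma free_algebra_induct [consumes 1, case_names zero add]:
  assumes f: "f \<in> carrier T"
    and zero: "Q \<zero>\<^bsub>T\<^esub>"
    and add: "\<And>g a w. g \<in> carrier T \<Longrightarrow> Q g \<Longrightarrow> a \<in> carrier k \<Longrightarrow> w \<in> lists I \<Longrightarrow> f w \<noteq> \<zero> \<Longrightarrow>
                Q (g \<oplus>\<^bsub>T\<^esub> monomial a w)"
  shows "Q f"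
proof -
  \<comment> \<open>The induction runs over a finite set containing the support, for all
    \<open>g\<close> supported inside the support of \<open>f\<close>.\<close>
  have "Q g" if "finite S" "g \<in> carrier T" "\<And>w. w \<notin> S \<Longrightarrow> g w = \<zero>" "\<And>w. g w \<noteq> \<zero> \<Longrightarrow> f w \<noteq> \<zero>" for S g
    using that
  proof (induction S arbitrary: g)
    case empty
    then have "g = \<zero>\<^bsub>T\<^esub>" by auto
    then show ?case using zero by simp
  next
    case (insert w S)
    show ?case
    proof (cases "g w = \<zero>")
      case True
      show ?thesis
      proof (rule insert.IH[OF insert.prems(1)])
        fix v assume "v \<notin> S"
        then show "g v = \<zero>" using True insert.prems(2) by (cases "v = w") auto
      qed (rule insert.prems(3))
    next
      case False
      let ?h = "\<lambda>v. if v = w then \<zero> else g v"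
      have h: "?h \<in> carrier T"
      proof (rule free_algebraI)
        show "finite {w. g w \<noteq> \<zero>}" using insert.prems by (intro finite_support)
      qed (use insert.prems support_lists in \<open>auto split: if_splits\<close>)
      have "Q (?h \<oplus>\<^bsub>T\<^esub> monomial (g w) w)"
      proof (rule add[OF h])
        show "Q ?h" using h insert.prems by (intro insert.IH) (auto split: if_splits)
      qed (use insert.prems False support_lists[OF insert.prems(1)] in auto)
      moreover have "?h \<oplus>\<^bsub>T\<^esub> monomial (g w) w = g"
        using insert.prems by (auto simp: monomial_def fun_eq_iff)
      ultimately show ?thesis by simp
    qed
  qed
  from this[OF finite_support[OF f] f] show ?thesis by auto
qed

end

section \<open>Leading forms of an ideal\<close>

lemma (in ideal) ideal_finsum_closed:
  assumes "f \<in> S \<rightarrow> I"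
  shows "finsum R f S \<in> I"
  using assms
proof (induction S rule: infinite_finite_induct)
  case (insert s S)
  then have "f \<in> S \<rightarrow> carrier R" "f s \<in> carrier R" by (auto intro!: Icarr)
  then have "finsum R f (insert s S) = f s \<oplus> finsum R f S"
    using insert.hyps by (intro finsum_insert)
  then show ?case using insert by simp
qed simp_all

context free_alg begin

text \<open>
  The elements of \<open>F\<^sub>d(T)\<close> with the same component of degree \<open>d\<close> as \<open>f\<close>, a coset of
  \<open>F\<^sub>d\<^sub>-\<^sub>1(T)\<close>; in this form the convention \<open>F\<^sub>-\<^sub>1 = 0\<close> needs no case distinction.
\<close>

definition lifts :: "nat \<Rightarrow> ('i list \<Rightarrow> 'k) \<Rightarrow> ('i list \<Rightarrow> 'k) set" where
  "lifts d f = {t \<in> carrier T. \<forall>w. d \<le> length w \<longrightarrow> t w = (if length w = d then f w else \<zero>)}"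

text \<open>The ideal \<open>G\<close> of the overview, formed for an arbitrary \<open>N\<close>: it
  consists of the sums of leading forms of elements of \<open>N\<close>.\<close>

definition leading_ideal :: "('i list \<Rightarrow> 'k) set \<Rightarrow> ('i list \<Rightarrow> 'k) set" where
  "leading_ideal N = {f \<in> carrier T. \<forall>d. N \<inter> lifts d f \<noteq> {}}"

lemma lifts_carrier: "t \<in> lifts d f \<Longrightarrow> t \<in> carrier T"
  by (simp add: lifts_def)

lemma lifts_add:
  "s \<in> lifts d f \<Longrightarrow> t \<in> lifts d g \<Longrightarrow> s \<oplus>\<^bsub>T\<^esub> t \<in> lifts d (f \<oplus>\<^bsub>T\<^esub> g)"
  using T.a_closed[of s t] by (auto simp: lifts_def)

lemma lifts_neg:
  "f \<in> carrier T \<Longrightarrow> s \<in> lifts d f \<Longrightarrow> \<ominus>\<^bsub>T\<^esub> s \<in> lifts d (\<ominus>\<^bsub>T\<^esub> f)"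
  using T.a_inv_closed[of s] by (auto simp: lifts_def neg_eq)

lemma lifts_diff:
  assumes "f \<in> carrier T" "s \<in> lifts d f" "t \<in> lifts d f"
  shows "s \<ominus>\<^bsub>T\<^esub> t \<in> lifts d \<zero>\<^bsub>T\<^esub>"
proof -
  have "s \<oplus>\<^bsub>T\<^esub> \<ominus>\<^bsub>T\<^esub> t \<in> lifts d (f \<oplus>\<^bsub>T\<^esub> \<ominus>\<^bsub>T\<^esub> f)"
    using assms by (intro lifts_add lifts_neg)
  then show ?thesis
    using T.r_neg[OF assms(1)] unfolding a_minus_def by argo
qed

lemma lifts_cong: "(\<And>w. length w = d \<Longrightarrow> f w = g w) \<Longrightarrow> lifts d f = lifts d g"
  unfolding lifts_def by (intro Collect_cong) auto

lemma component_carrier: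
  "f \<in> carrier T \<Longrightarrow> homogeneous_component k d f \<in> carrier T"
  by (rule free_algebraI[of _ "{w. f w \<noteq> \<zero>}"])
    (auto simp: homogeneous_component_def finite_support dest: support_lists split: if_splits)

lemma component_lifts:
  "f \<in> carrier T \<Longrightarrow> homogeneous_component k d f \<in> lifts d f"
  using component_carrier[of f d] by (auto simp: lifts_def homogeneous_component_def)

lemma lifts_self: "t \<in> tensor_filtration k I d \<Longrightarrow> t \<in> lifts d t"
  by (force simp: lifts_def tensor_filtration_def)

lemma lifts_filtration: "t \<in> lifts d f \<Longrightarrow> t \<in> tensor_filtration k I d"
  by (force simp: lifts_def tensor_filtration_def split: if_splits)

lemma lifts_eq:
  assumes f: "f \<in> carrier T" and t: "t \<in> lifts d f"
  shows "lifts d f = (\<lambda>s. s \<oplus>\<^bsub>T\<^esub> t) ` lifts d \<zero>\<^bsub>T\<^esub>"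
proof (intro equalityI subsetI)
  fix s assume s: "s \<in> lifts d f"
  have "s = (s \<ominus>\<^bsub>T\<^esub> t) \<oplus>\<^bsub>T\<^esub> t"
    using lifts_carrier[OF s] lifts_carrier[OF t] by (simp add: T.minus_eq T.a_assoc T.l_neg del: free_algebra_sel)
  then show "s \<in> (\<lambda>s. s \<oplus>\<^bsub>T\<^esub> t) ` lifts d \<zero>\<^bsub>T\<^esub>"
    using lifts_diff[OF f s t] by blast
next
  fix s assume "s \<in> (\<lambda>s. s \<oplus>\<^bsub>T\<^esub> t) ` lifts d \<zero>\<^bsub>T\<^esub>"
  then obtain r where "r \<in> lifts d \<zero>\<^bsub>T\<^esub>" "s = r \<oplus>\<^bsub>T\<^esub> t" by blast
  then show "s \<in> lifts d f"
    using lifts_add[of r d "\<zero>\<^bsub>T\<^esub>" t f] t T.l_zero[OF f] by argo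
qed

lemma lifts_zero_length:
  assumes "f \<in> lifts d \<zero>\<^bsub>T\<^esub>" "f w \<noteq> \<zero>"
  shows "length w < d"
  using assms by (intro not_le_imp_less notI) (simp add: lifts_def)

lemma lifts_mult:
  assumes f: "f \<in> carrier T" and g: "g \<in> carrier T"
    and a: "\<And>i. i \<le> d \<Longrightarrow> a i \<in> lifts i f" and b: "\<And>i. i \<le> d \<Longrightarrow> b i \<in> lifts i g"
  shows "(\<Oplus>\<^bsub>T\<^esub>i\<in>{..d}. a i \<otimes>\<^bsub>T\<^esub> b (d - i)) \<in> lifts d (f \<otimes>\<^bsub>T\<^esub> g)"
proof -
  have aT: "a i \<in> carrier T" and bT: "b i \<in> carrier T" if "i \<le> d" for i
    using a b that lifts_carrier by blast+
  have ab: "(\<lambda>i. a i \<otimes>\<^bsub>T\<^esub> b (d - i)) \<in> {..d} \<rightarrow> carrier T"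
    using aT bT by auto
  have val: "a i u = (if length u = i then f u else \<zero>)" if "i \<le> d" "i \<le> length u" for i u
    using a that by (simp add: lifts_def)
  have valb: "b i u = (if length u = i then g u else \<zero>)" if "i \<le> d" "i \<le> length u" for i u
    using b that by (simp add: lifts_def)
  have summand: "(a i \<otimes>\<^bsub>T\<^esub> b (d - i)) w =
      (if length w = d then f (take i w) \<otimes> g (drop i w) else \<zero>)"
    if i: "i \<le> d" and w: "d \<le> length w" for i w
  proof -
    have "(a i \<otimes>\<^bsub>T\<^esub> b (d - i)) w =
        (\<Oplus>m\<in>{..length w}. if i = m then (if length w = d then f (take m w) \<otimes> g (drop m w) else \<zero>) else \<zero>)"
      unfolding mult_free_algebra
    proof (rule finsum_cong', rule refl)
      fix m assume m: "m \<in> {..length w}"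
      have c: "a i (take m w) \<in> carrier k" "b (d - i) (drop m w) \<in> carrier k"
        using aT[OF i] bT[of "d - i"] by auto
      \<comment> \<open>A split before \<open>i\<close> leaves a right part longer than
        \<open>d - i\<close>, a split after \<open>i\<close> a left part longer than
        \<open>i\<close>; in both cases one factor vanishes by its degree bound.\<close>
      consider "m < i" | "m = i" | "m > i" by linarith
      then show "a i (take m w) \<otimes> b (d - i) (drop m w) =
          (if i = m then (if length w = d then f (take m w) \<otimes> g (drop m w) else \<zero>) else \<zero>)"
      proof cases
        case 1
        then have "b (d - i) (drop m w) = \<zero>" using i w m by (subst valb) auto
        then show ?thesis using 1 c by simp
      next
        case 2
        then show ?thesis using i w m f by (subst val, simp, simp, subst valb) auto
      next
        case 3
        then have "a i (take m w) = \<zero>" using i w m by (subst val) auto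
        then show ?thesis using 3 c by simp
      qed
    qed (use f g in auto)
    also have "\<dots> = (if length w = d then f (take i w) \<otimes> g (drop i w) else \<zero>)"
      using i w f g by (intro finsum_singleton) auto
    finally show ?thesis .
  qed
  have "(\<Oplus>\<^bsub>T\<^esub>i\<in>{..d}. a i \<otimes>\<^bsub>T\<^esub> b (d - i)) w = (if length w = d then (f \<otimes>\<^bsub>T\<^esub> g) w else \<zero>)"
    if w: "d \<le> length w" for w
  proof -
    have "(\<Oplus>\<^bsub>T\<^esub>i\<in>{..d}. a i \<otimes>\<^bsub>T\<^esub> b (d - i)) w =
        (\<Oplus>i\<in>{..d}. if length w = d then f (take i w) \<otimes> g (drop i w) else \<zero>)"
      unfolding finsum_coeff[OF ab] using f g w
      by (intro finsum_cong') (auto simp: summand)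
    then show ?thesis by (auto simp: mult_free_algebra)
  qed
  then show ?thesis
    using ab T.finsum_closed by (auto simp: lifts_def)
qed

section \<open>The ideal of leading forms\<close>

lemma leading_idealI:
  "f \<in> carrier T \<Longrightarrow> (\<And>d. \<exists>t. t \<in> N \<and> t \<in> lifts d f) \<Longrightarrow> f \<in> leading_ideal N"
  by (fastforce simp: leading_ideal_def)

lemma leading_idealD: "f \<in> leading_ideal N \<Longrightarrow> \<exists>t. t \<in> N \<and> t \<in> lifts d f"
  by (auto simp: leading_ideal_def)

lemma leading_idealE:
  assumes "f \<in> leading_ideal N"
  obtains t where "\<And>d. t d \<in> N" "\<And>d. t d \<in> lifts d f"
proof -
  show thesis using that leading_idealD[OF assms] by metis
qed

lemma ideal_leading_ideal:
  assumes "ideal N T"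
  shows "ideal (leading_ideal N) T"
proof -
  interpret N: ideal N T by fact
  have mem: "f \<in> carrier T" if "f \<in> leading_ideal N" for f
    using that by (simp add: leading_ideal_def)
  show ?thesis
  proof (rule idealI[OF ring_free_algebra])
    show "subgroup (leading_ideal N) (add_monoid T)"
    proof
      show "leading_ideal N \<subseteq> carrier (add_monoid T)" using mem by auto
    next
      fix f g assume f: "f \<in> leading_ideal N" and g: "g \<in> leading_ideal N"
      obtain s where s: "\<And>d. s d \<in> N" "\<And>d. s d \<in> lifts d f" using leading_idealE[OF f] by metis
      obtain t where t: "\<And>d. t d \<in> N" "\<And>d. t d \<in> lifts d g" using leading_idealE[OF g] by metis
      have "f \<oplus>\<^bsub>T\<^esub> g \<in> leading_ideal N"
      proof (rule leading_idealI)
        show "f \<oplus>\<^bsub>T\<^esub> g \<in> carrier T" using f g mem by (intro T.a_closed)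
        show "\<exists>r. r \<in> N \<and> r \<in> lifts d (f \<oplus>\<^bsub>T\<^esub> g)" for d
          using N.a_closed[OF s(1)[of d] t(1)[of d]] lifts_add[OF s(2)[of d] t(2)[of d]] by blast
      qed
      then show "f \<otimes>\<^bsub>add_monoid T\<^esub> g \<in> leading_ideal N" by simp
    next
      show "\<one>\<^bsub>add_monoid T\<^esub> \<in> leading_ideal N"
        using N.zero_closed T.zero_closed
        by (intro leading_idealI) (auto simp: lifts_def)
    next
      fix f assume f: "f \<in> leading_ideal N"
      obtain s where s: "\<And>d. s d \<in> N" "\<And>d. s d \<in> lifts d f" using leading_idealE[OF f] by metis
      have "\<ominus>\<^bsub>T\<^esub> f \<in> leading_ideal N"
      proof (rule leading_idealI)
        show "\<ominus>\<^bsub>T\<^esub> f \<in> carrier T" using f mem by (intro T.a_inv_closed)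
        show "\<exists>r. r \<in> N \<and> r \<in> lifts d (\<ominus>\<^bsub>T\<^esub> f)" for d
          using N.a_inv_closed[OF s(1)[of d]] lifts_neg[OF mem[OF f] s(2)[of d]] by blast
      qed
      then show "inv\<^bsub>add_monoid T\<^esub> f \<in> leading_ideal N" by (simp add: a_inv_def)
    qed
    fix f g assume f: "f \<in> leading_ideal N" and g: "g \<in> carrier T"
    obtain s where s: "\<And>d. s d \<in> N" "\<And>d. s d \<in> lifts d f" using leading_idealE[OF f] by metis
    show "g \<otimes>\<^bsub>T\<^esub> f \<in> leading_ideal N"
    proof (rule leading_idealI)
      show "g \<otimes>\<^bsub>T\<^esub> f \<in> carrier T" using f g mem by blast
      \<comment> \<open>The multiplier \<open>g\<close> is lifted by its own homogeneous components;
        every term of the resulting sum has a factor in \<open>N\<close>, so the sum is a lift in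
        \<open>N\<close>.\<close>
      show "\<exists>r. r \<in> N \<and> r \<in> lifts d (g \<otimes>\<^bsub>T\<^esub> f)" for d
        using lifts_mult[OF g mem[OF f] component_lifts[OF g] s(2)]
          N.ideal_finsum_closed[of "\<lambda>i. homogeneous_component k i g \<otimes>\<^bsub>T\<^esub> s (d - i)" "{..d}"]
          N.I_l_closed[OF s(1) component_carrier[OF g]] by blast
    qed
    show "f \<otimes>\<^bsub>T\<^esub> g \<in> leading_ideal N"
    proof (rule leading_idealI)
      show "f \<otimes>\<^bsub>T\<^esub> g \<in> carrier T" using f g mem by blast
      show "\<exists>r. r \<in> N \<and> r \<in> lifts d (f \<otimes>\<^bsub>T\<^esub> g)" for d
        using lifts_mult[OF mem[OF f] g s(2) component_lifts[OF g]]
          N.ideal_finsum_closed[of "\<lambda>i. s i \<otimes>\<^bsub>T\<^esub> homogeneous_component k (d - i) g" "{..d}"]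
          N.I_r_closed[OF s(1) component_carrier[OF g]] by blast
    qed
  qed
qed

text \<open>As leading forms make up an ideal, only generators matter: \<open>p\<close> lifts its
  quadratic part in degree 2, and zero lifts it in every other degree.\<close>

lemma genideal_components_leading:
  assumes "P \<subseteq> tensor_filtration k I 2"
  shows "genideal T (homogeneous_component k 2 ` P) \<subseteq> leading_ideal (genideal T P)"
proof (rule T.genideal_minimal)
  have PT: "P \<subseteq> carrier T" using assms by (auto simp: tensor_filtration_def)
  interpret N: ideal "genideal T P" T by (rule T.genideal_ideal[OF PT])
  show "ideal (leading_ideal (genideal T P)) T"
    by (rule ideal_leading_ideal) (rule T.genideal_ideal[OF PT])
  show "homogeneous_component k 2 ` P \<subseteq> leading_ideal (genideal T P)"
  proof (intro image_subsetI leading_idealI)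
    fix p d assume p: "p \<in> P"
    then show "homogeneous_component k 2 p \<in> carrier T" using PT component_carrier by blast
    show "\<exists>t. t \<in> genideal T P \<and> t \<in> lifts d (homogeneous_component k 2 p)"
    proof (cases "d = 2")
      case True
      have "p \<in> lifts 2 p" using p assms lifts_self by blast
      then have "p \<in> lifts 2 (homogeneous_component k 2 p)"
        by (subst lifts_cong[of 2 _ p]) (auto simp: homogeneous_component_def)
      then show ?thesis using p PT T.genideal_self True by blast
    next
      case False
      then have "\<zero>\<^bsub>T\<^esub> \<in> lifts d (homogeneous_component k 2 p)"
        using T.zero_closed by (auto simp: lifts_def homogeneous_component_def)
      then show ?thesis using N.zero_closed by blast
    qed
  qed
qed

end

section \<open>Straightening words\<close>

text \<open>\<open>swap\<close> is stated for pairs out of order, which directs the rewriting: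
  smaller letters move left. \<open>J\<close> is kept abstract; all that is derived from the rule is
  the existence of sorted representatives.\<close>

locale straightening = free_alg k I
  for k :: "('k, 'm) ring_scheme" (structure) and I :: "'i::linorder set" +
  fixes J :: "('i list \<Rightarrow> 'k) set"
  assumes J_ideal: "ideal J T"
    and swap: "\<And>i j. i \<in> I \<Longrightarrow> j \<in> I \<Longrightarrow> i < j \<Longrightarrow>
      \<exists>c\<in>carrier k. monomial \<one> [j, i] \<ominus>\<^bsub>T\<^esub> monomial c [i, j] \<in> J"
begin

interpretation J: ideal J T by (rule J_ideal)

section \<open>Congruence modulo the ideal\<close>

lemma diff_trans:
  assumes "f \<in> carrier T" "g \<in> carrier T" "h \<in> carrier T"
    "f \<ominus>\<^bsub>T\<^esub> g \<in> J" "g \<ominus>\<^bsub>T\<^esub> h \<in> J"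
  shows "f \<ominus>\<^bsub>T\<^esub> h \<in> J"
proof -
  have "f \<ominus>\<^bsub>T\<^esub> h = (f \<ominus>\<^bsub>T\<^esub> g) \<oplus>\<^bsub>T\<^esub> (g \<ominus>\<^bsub>T\<^esub> h)"
    using assms(1-3) by (simp add: T.minus_eq T.a_assoc T.r_neg1 del: free_algebra_sel)
  then show ?thesis using J.a_closed[OF assms(4,5)] by argo
qed

lemma diff_mult_left:
  assumes "f \<in> carrier T" "g \<in> carrier T" "h \<in> carrier T" "f \<ominus>\<^bsub>T\<^esub> g \<in> J"
  shows "h \<otimes>\<^bsub>T\<^esub> f \<ominus>\<^bsub>T\<^esub> h \<otimes>\<^bsub>T\<^esub> g \<in> J"
proof -
  have "h \<otimes>\<^bsub>T\<^esub> f \<ominus>\<^bsub>T\<^esub> h \<otimes>\<^bsub>T\<^esub> g = h \<otimes>\<^bsub>T\<^esub> (f \<ominus>\<^bsub>T\<^esub> g)"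
    using assms(1-3) by (simp add: T.minus_eq T.r_distr T.r_minus del: free_algebra_sel)
  then show ?thesis using J.I_l_closed[OF assms(4,3)] by argo
qed

lemma diff_mult_right:
  assumes "f \<in> carrier T" "g \<in> carrier T" "h \<in> carrier T" "f \<ominus>\<^bsub>T\<^esub> g \<in> J"
  shows "f \<otimes>\<^bsub>T\<^esub> h \<ominus>\<^bsub>T\<^esub> g \<otimes>\<^bsub>T\<^esub> h \<in> J"
proof -
  have "f \<otimes>\<^bsub>T\<^esub> h \<ominus>\<^bsub>T\<^esub> g \<otimes>\<^bsub>T\<^esub> h = (f \<ominus>\<^bsub>T\<^esub> g) \<otimes>\<^bsub>T\<^esub> h"
    using assms(1-3) by (simp add: T.minus_eq T.l_distr T.l_minus del: free_algebra_sel)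
  then show ?thesis using J.I_r_closed[OF assms(4,3)] by argo
qed

lemma diff_add:
  assumes "f \<in> carrier T" "g \<in> carrier T" "f' \<in> carrier T" "g' \<in> carrier T"
    "f \<ominus>\<^bsub>T\<^esub> f' \<in> J" "g \<ominus>\<^bsub>T\<^esub> g' \<in> J"
  shows "(f \<oplus>\<^bsub>T\<^esub> g) \<ominus>\<^bsub>T\<^esub> (f' \<oplus>\<^bsub>T\<^esub> g') \<in> J"
proof -
  have "(f \<oplus>\<^bsub>T\<^esub> g) \<ominus>\<^bsub>T\<^esub> (f' \<oplus>\<^bsub>T\<^esub> g') = (f \<ominus>\<^bsub>T\<^esub> f') \<oplus>\<^bsub>T\<^esub> (g \<ominus>\<^bsub>T\<^esub> g')"
    using assms(1-4) by (simp add: T.minus_eq T.minus_add T.a_ac del: free_algebra_sel)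
  then show ?thesis using J.a_closed[OF assms(5,6)] by argo
qed

lemma monom_diff_scale:
  assumes "a \<in> carrier k" "s \<in> carrier k" "u \<in> lists I" "v \<in> lists I"
    "monomial \<one> u \<ominus>\<^bsub>T\<^esub> monomial s v \<in> J"
  shows "monomial a u \<ominus>\<^bsub>T\<^esub> monomial (a \<otimes> s) v \<in> J"
  using diff_mult_left[of "monomial \<one> u" "monomial s v" "monomial a []"] assms
  by (simp add: mult_monom_monom del: free_algebra_sel)

text \<open>Multiplying by \<open>p\<close> on the left and by \<open>q\<close> on the right
  rewrites a factor inside a word, because the ideal is two-sided.\<close>

lemma monom_diff_append:
  assumes "s \<in> carrier k" "u \<in> lists I" "v \<in> lists I" "p \<in> lists I" "q \<in> lists I"
    "monomial \<one> u \<ominus>\<^bsub>T\<^esub> monomial s v \<in> J"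
  shows "monomial \<one> (p @ u @ q) \<ominus>\<^bsub>T\<^esub> monomial s (p @ v @ q) \<in> J"
proof -
  have "monomial \<one> (u @ q) \<ominus>\<^bsub>T\<^esub> monomial s (v @ q) \<in> J"
    using diff_mult_right[of "monomial \<one> u" "monomial s v" "monomial \<one> q"] assms
    by (simp add: mult_monom_monom del: free_algebra_sel)
  then show ?thesis
    using diff_mult_left[of "monomial \<one> (u @ q)" "monomial s (v @ q)" "monomial \<one> p"] assms
    by (simp add: mult_monom_monom del: free_algebra_sel)
qed

lemma monom_diff_trans:
  assumes "s \<in> carrier k" "t \<in> carrier k" "u \<in> lists I" "v \<in> lists I" "w \<in> lists I"
    "monomial \<one> u \<ominus>\<^bsub>T\<^esub> monomial s v \<in> J" "monomial \<one> v \<ominus>\<^bsub>T\<^esub> monomial t w \<in> J"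
  shows "monomial \<one> u \<ominus>\<^bsub>T\<^esub> monomial (s \<otimes> t) w \<in> J"
  using diff_trans[OF _ _ _ assms(6) monom_diff_scale[OF assms(1,2,4,5,7)]] assms by simp

section \<open>Insertion sort on words\<close>

lemma set_insort_lists: "a \<in> I \<Longrightarrow> v \<in> lists I \<Longrightarrow> insort a v \<in> lists I"
  by (auto simp: in_lists_conv_set set_insort_key)

lemma sort_lists: "w \<in> lists I \<Longrightarrow> sort w \<in> lists I"
  by (auto simp: in_lists_conv_set)

lemma monom_diff_refl: "w \<in> lists I \<Longrightarrow> monomial \<one> w \<ominus>\<^bsub>T\<^esub> monomial \<one> w \<in> J"
  using J.zero_closed T.r_neg[of "monomial \<one> w"] by (simp add: T.minus_eq del: free_algebra_sel)

text \<open>The letter \<open>a\<close> travels to the right past each smaller letter, and the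
  constants of the swaps multiply up to \<open>s\<close>.\<close>

lemma insort_word:
  assumes "a \<in> I" "v \<in> lists I"
  shows "\<exists>s\<in>carrier k. monomial \<one> (a # v) \<ominus>\<^bsub>T\<^esub> monomial s (insort a v) \<in> J"
  using assms(2)
proof (induction v)
  case Nil
  show ?case using monom_diff_refl[of "[a]"] assms(1) by (intro bexI[of _ \<one>]) auto
next
  case (Cons b v)
  show ?case
  proof (cases "a \<le> b")
    case True
    then show ?thesis
      using monom_diff_refl[of "a # b # v"] assms(1) Cons.hyps by (intro bexI[of _ \<one>]) auto
  next
    case False
    obtain c where c: "c \<in> carrier k" "monomial \<one> [a, b] \<ominus>\<^bsub>T\<^esub> monomial c [b, a] \<in> J"
      using swap[of b a] False assms(1) Cons.hyps by (auto simp: not_le)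
    obtain s where s: "s \<in> carrier k" "monomial \<one> (a # v) \<ominus>\<^bsub>T\<^esub> monomial s (insort a v) \<in> J"
      using Cons.IH by blast
    \<comment> \<open>The swap happens in front of \<open>v\<close>; the insertion into
      \<open>v\<close> is then carried out behind the letter \<open>b\<close>.\<close>
    have "monomial \<one> (a # b # v) \<ominus>\<^bsub>T\<^esub> monomial c (b # a # v) \<in> J"
      using monom_diff_append[OF c(1) _ _ _ _ c(2), of "[]" v] assms(1) Cons.hyps by simp
    moreover have "monomial \<one> (b # a # v) \<ominus>\<^bsub>T\<^esub> monomial s (b # insort a v) \<in> J"
      using monom_diff_append[OF s(1) _ _ _ _ s(2), of "[b]" "[]"] assms(1) Cons.hyps set_insort_lists
      by simp
    ultimately have "monomial \<one> (a # b # v) \<ominus>\<^bsub>T\<^esub> monomial (c \<otimes> s) (b # insort a v) \<in> J"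
      using assms(1) Cons.hyps set_insort_lists
      by (intro monom_diff_trans[OF c(1) s(1), of _ "b # a # v"]) simp_all
    then show ?thesis using False c s by auto
  qed
qed

text \<open>\<open>sort\<close> unfolds to repeated \<open>insort\<close>, so each letter costs one
  application of \<open>insort_word\<close>.\<close>

lemma sort_word:
  assumes "w \<in> lists I"
  shows "\<exists>s\<in>carrier k. monomial \<one> w \<ominus>\<^bsub>T\<^esub> monomial s (sort w) \<in> J"
  using assms
proof (induction w)
  case Nil
  show ?case using monom_diff_refl[of "[]"] by auto
next
  case (Cons a w)
  obtain s where s: "s \<in> carrier k" "monomial \<one> w \<ominus>\<^bsub>T\<^esub> monomial s (sort w) \<in> J"
    using Cons.IH by blast
  obtain t where t: "t \<in> carrier k"
    "monomial \<one> (a # sort w) \<ominus>\<^bsub>T\<^esub> monomial t (insort a (sort w)) \<in> J"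
    using insort_word[of a "sort w"] Cons.hyps sort_lists by blast
  have "monomial \<one> (a # w) \<ominus>\<^bsub>T\<^esub> monomial s (a # sort w) \<in> J"
    using monom_diff_append[OF s(1) _ _ _ _ s(2), of "[a]" "[]"] Cons.hyps sort_lists by simp
  then have "monomial \<one> (a # w) \<ominus>\<^bsub>T\<^esub> monomial (s \<otimes> t) (insort a (sort w)) \<in> J"
    using monom_diff_trans[OF s(1) t(1) _ _ _ _ t(2)] Cons.hyps sort_lists set_insort_lists by simp
  then show ?case using s t by auto
qed

section \<open>Reduction of polynomials to sorted words\<close>

definition sorted_below :: "nat \<Rightarrow> ('i list \<Rightarrow> 'k) set" where
  "sorted_below d = {g \<in> carrier T. \<forall>w. g w \<noteq> \<zero> \<longrightarrow> sorted w \<and> length w < d}"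

lemma sorted_below_add:
  assumes "f \<in> sorted_below d" "g \<in> sorted_below d"
  shows "f \<oplus>\<^bsub>T\<^esub> g \<in> sorted_below d"
proof -
  have "f \<oplus>\<^bsub>T\<^esub> g \<in> carrier T" using assms unfolding sorted_below_def by blast
  moreover have "f w \<noteq> \<zero> \<or> g w \<noteq> \<zero>" if "(f \<oplus>\<^bsub>T\<^esub> g) w \<noteq> \<zero>" for w using that by auto
  ultimately show ?thesis using assms unfolding sorted_below_def by blast
qed

lemma sorted_below_neg: "f \<in> sorted_below d \<Longrightarrow> \<ominus>\<^bsub>T\<^esub> f \<in> sorted_below d"
  using T.a_inv_closed[of f] by (auto simp: sorted_below_def neg_eq)

text \<open>Sorting preserves the length of a word, so reduction modulo \<open>J\<close> keeps the
  degree bound.\<close>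

lemma straighten:
  assumes f: "f \<in> carrier T" and len: "\<And>w. f w \<noteq> \<zero> \<Longrightarrow> length w < d"
  shows "\<exists>g\<in>sorted_below d. f \<ominus>\<^bsub>T\<^esub> g \<in> J"
  using f
proof (induction rule: free_algebra_induct)
  case zero
  have "\<zero>\<^bsub>T\<^esub> \<in> sorted_below d" using T.zero_closed by (simp add: sorted_below_def)
  moreover have "\<zero>\<^bsub>T\<^esub> \<ominus>\<^bsub>T\<^esub> \<zero>\<^bsub>T\<^esub> \<in> J" using J.zero_closed T.r_neg[OF T.zero_closed] by (simp add: T.minus_eq del: free_algebra_sel)
  ultimately show ?case by blast
next
  case (add g a w)
  obtain g' where g': "g' \<in> sorted_below d" "g \<ominus>\<^bsub>T\<^esub> g' \<in> J" using add.IH by blast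
  obtain s where s: "s \<in> carrier k" "monomial \<one> w \<ominus>\<^bsub>T\<^esub> monomial s (sort w) \<in> J"
    using sort_word[OF add.hyps(3)] by blast
  let ?m = "monomial (a \<otimes> s) (sort w)"
  have m: "?m \<in> sorted_below d"
    using add.hyps s(1) sort_lists[OF add.hyps(3)] len[OF add.hyps(4)] monom_carrier[of "a \<otimes> s" "sort w"]
    by (auto simp: sorted_below_def monomial_def)
  have "monomial a w \<ominus>\<^bsub>T\<^esub> ?m \<in> J"
    using monom_diff_scale[OF add.hyps(2) s(1) add.hyps(3) sort_lists s(2)] add.hyps by simp
  then have "(g \<oplus>\<^bsub>T\<^esub> monomial a w) \<ominus>\<^bsub>T\<^esub> (g' \<oplus>\<^bsub>T\<^esub> ?m) \<in> J"
    using g' m add.hyps by (intro diff_add) (auto simp: sorted_below_def)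
  then show ?case using sorted_below_add[OF g'(1) m] by blast
qed

lemma diff_cancel:
  assumes "f \<in> carrier T" "g \<in> carrier T" "h \<in> carrier T"
  shows "((f \<ominus>\<^bsub>T\<^esub> g) \<ominus>\<^bsub>T\<^esub> h) \<oplus>\<^bsub>T\<^esub> g = f \<ominus>\<^bsub>T\<^esub> h"
proof -
  have "((f \<ominus>\<^bsub>T\<^esub> g) \<ominus>\<^bsub>T\<^esub> h) \<oplus>\<^bsub>T\<^esub> g = (f \<ominus>\<^bsub>T\<^esub> h) \<oplus>\<^bsub>T\<^esub> (\<ominus>\<^bsub>T\<^esub> g \<oplus>\<^bsub>T\<^esub> g)"
    using assms by (simp add: T.minus_eq T.a_ac del: free_algebra_sel T.l_neg T.r_neg)
  then show ?thesis using assms by (simp add: T.l_neg del: free_algebra_sel)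
qed

text \<open>Reduction modulo \<open>J\<close> leaves a difference that is a sum of leading forms of
  \<open>N\<close>. Subtracting an element of \<open>N\<close> with the same top component lowers
  the degree, and the induction hypothesis treats the rest.\<close>

lemma straighten_lower:
  assumes N: "ideal N T" and JN: "J \<subseteq> leading_ideal N"
    and f: "f \<in> carrier T" "\<And>w. f w \<noteq> \<zero> \<Longrightarrow> length w < d"
  shows "\<exists>g\<in>sorted_below d. f \<ominus>\<^bsub>T\<^esub> g \<in> N"
  using f
proof (induction d arbitrary: f)
  interpret N: ideal N T by (rule N)
  case 0
  \<comment> \<open>The bound is strict, so at 0 only the zero polynomial is left and the induction
    starts without a separate treatment of constants.\<close>
  have "f w = \<zero>" for w using "0.prems"(2)[of w] by blast
  then have "f = \<zero>\<^bsub>T\<^esub>" by (simp add: fun_eq_iff)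
  moreover have "\<zero>\<^bsub>T\<^esub> \<in> sorted_below 0" using T.zero_closed by (simp add: sorted_below_def)
  moreover have "\<zero>\<^bsub>T\<^esub> \<ominus>\<^bsub>T\<^esub> \<zero>\<^bsub>T\<^esub> \<in> N" using N.zero_closed T.r_neg[OF T.zero_closed] by (simp add: T.minus_eq del: free_algebra_sel)
  ultimately show ?case by blast
next
  interpret N: ideal N T by (rule N)
  case (Suc d)
  obtain g where g: "g \<in> sorted_below (Suc d)" "f \<ominus>\<^bsub>T\<^esub> g \<in> J"
    using straighten[OF Suc.prems] by blast
  have gT: "g \<in> carrier T" using g(1) by (simp add: sorted_below_def)
  have fgT: "f \<ominus>\<^bsub>T\<^esub> g \<in> carrier T" using Suc.prems(1) gT by (rule T.minus_closed)
  \<comment> \<open>The bound \<open>Suc d\<close> allows lengths up to \<open>d\<close>, so the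
    lift in degree \<open>d\<close> is the one that cancels the top component.\<close>
  obtain t where t: "t \<in> N" "t \<in> lifts d (f \<ominus>\<^bsub>T\<^esub> g)"
    using leading_idealD[OF subsetD[OF JN g(2)]] by blast
  have tT: "t \<in> carrier T" using t(2) by (rule lifts_carrier)
  have "f \<ominus>\<^bsub>T\<^esub> g \<in> tensor_filtration k I d"
  proof -
    have "length w \<le> d" if "(f \<ominus>\<^bsub>T\<^esub> g) w \<noteq> \<zero>" for w
    proof -
      have "f w \<noteq> \<zero> \<or> g w \<noteq> \<zero>" using that Suc.prems(1) gT by (auto simp: diff_eq minus_eq)
      then show ?thesis using Suc.prems(2)[of w] g(1) by (auto simp: sorted_below_def)
    qed
    then show ?thesis using fgT by (simp add: tensor_filtration_def)
  qed
  then have r: "(f \<ominus>\<^bsub>T\<^esub> g) \<ominus>\<^bsub>T\<^esub> t \<in> lifts d \<zero>\<^bsub>T\<^esub>"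
    using lifts_diff[OF fgT lifts_self t(2)] by blast
  have "length w < d" if "((f \<ominus>\<^bsub>T\<^esub> g) \<ominus>\<^bsub>T\<^esub> t) w \<noteq> \<zero>" for w
    using lifts_zero_length[OF r that] .
  then obtain g' where g': "g' \<in> sorted_below d" "((f \<ominus>\<^bsub>T\<^esub> g) \<ominus>\<^bsub>T\<^esub> t) \<ominus>\<^bsub>T\<^esub> g' \<in> N"
    using Suc.IH[OF lifts_carrier[OF r]] by blast
  have g'S: "g' \<in> sorted_below (Suc d)" and g'T: "g' \<in> carrier T"
    using g'(1) by (auto simp: sorted_below_def)
  \<comment> \<open>The correction \<open>t\<close> is put back: it lies in \<open>N\<close> itself,
    so it does not affect the congruence.\<close>
  have "f \<ominus>\<^bsub>T\<^esub> (g \<oplus>\<^bsub>T\<^esub> g') = (((f \<ominus>\<^bsub>T\<^esub> g) \<ominus>\<^bsub>T\<^esub> t) \<ominus>\<^bsub>T\<^esub> g') \<oplus>\<^bsub>T\<^esub> t"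
    unfolding diff_cancel[OF fgT tT g'T] using Suc.prems(1) gT g'T
    by (simp add: T.minus_eq T.minus_add T.a_assoc del: free_algebra_sel)
  then have "f \<ominus>\<^bsub>T\<^esub> (g \<oplus>\<^bsub>T\<^esub> g') \<in> N" using N.a_closed[OF g'(2) t(1)] by argo
  then show ?case using sorted_below_add[OF g(1) g'S] by blast
qed

text \<open>Modulo \<open>J\<close> an element of the leading ideal becomes a sorted
  \<open>g\<close>, still in the leading ideal. A component of \<open>g\<close> is then congruent
  modulo \<open>N\<close> to a sorted polynomial \<open>u'\<close> of lower degree, and independence
  forces their difference to be zero.\<close>

lemma leading_ideal_subset:
  assumes N: "ideal N T" and JN: "J \<subseteq> leading_ideal N"
    and indep: "\<And>g d. g \<in> sorted_below d \<Longrightarrow> g \<in> N \<Longrightarrow> g = \<zero>\<^bsub>T\<^esub>"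
  shows "leading_ideal N \<subseteq> J"
proof
  interpret N: ideal N T by (rule N)
  interpret L: ideal "leading_ideal N" T by (rule ideal_leading_ideal[OF N])
  fix f assume fL: "f \<in> leading_ideal N"
  then have f: "f \<in> carrier T" by (rule L.Icarr)
  obtain e where "\<And>w. f w \<noteq> \<zero> \<Longrightarrow> length w < e" using exists_length_bound[OF f] by metis
  then obtain g where g: "g \<in> sorted_below e" "f \<ominus>\<^bsub>T\<^esub> g \<in> J" using straighten[OF f] by blast
  have gT: "g \<in> carrier T" using g(1) by (simp add: sorted_below_def)
  have "g = f \<oplus>\<^bsub>T\<^esub> \<ominus>\<^bsub>T\<^esub> (f \<ominus>\<^bsub>T\<^esub> g)"
    using f gT by (simp add: T.minus_eq T.minus_add T.r_neg2 del: free_algebra_sel)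
  also have "\<dots> \<in> leading_ideal N" using g(2) JN fL by (intro L.a_closed L.a_inv_closed) auto
  finally have gL: "g \<in> leading_ideal N" .
  have "g w = \<zero>" for w
  proof -
    let ?d = "length w" and ?h = "homogeneous_component k (length w) g"
    have hT: "?h \<in> carrier T" and hl: "?h \<in> lifts ?d g"
      using component_carrier component_lifts gT by blast+
    obtain t where t: "t \<in> N" "t \<in> lifts ?d g" using leading_idealD[OF gL] by blast
    have tT: "t \<in> carrier T" using t(2) by (rule lifts_carrier)
    have u: "?h \<ominus>\<^bsub>T\<^esub> t \<in> lifts ?d \<zero>\<^bsub>T\<^esub>" by (rule lifts_diff[OF gT hl t(2)])
    have "length v < ?d" if "(?h \<ominus>\<^bsub>T\<^esub> t) v \<noteq> \<zero>" for v
      using lifts_zero_length[OF u that] .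
    then obtain u' where u': "u' \<in> sorted_below ?d" "(?h \<ominus>\<^bsub>T\<^esub> t) \<ominus>\<^bsub>T\<^esub> u' \<in> N"
      using straighten_lower[OF N JN lifts_carrier[OF u]] by blast
    have u'T: "u' \<in> carrier T" using u'(1) by (simp add: sorted_below_def)
    have "?h \<oplus>\<^bsub>T\<^esub> \<ominus>\<^bsub>T\<^esub> u' = ((?h \<ominus>\<^bsub>T\<^esub> t) \<ominus>\<^bsub>T\<^esub> u') \<oplus>\<^bsub>T\<^esub> t"
      unfolding diff_cancel[OF hT tT u'T] by (rule T.minus_eq[symmetric])
    then have "?h \<oplus>\<^bsub>T\<^esub> \<ominus>\<^bsub>T\<^esub> u' \<in> N" using N.a_closed[OF u'(2) t(1)] by argo
    moreover have "?h \<in> sorted_below (Suc ?d)" "u' \<in> sorted_below (Suc ?d)"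
      using hT g(1) u'(1) by (auto simp: sorted_below_def homogeneous_component_def split: if_splits)
    ultimately have "?h \<oplus>\<^bsub>T\<^esub> \<ominus>\<^bsub>T\<^esub> u' = \<zero>\<^bsub>T\<^esub>"
      by (intro indep[of _ "Suc ?d"] sorted_below_add sorted_below_neg)
    then have "(?h \<oplus>\<^bsub>T\<^esub> \<ominus>\<^bsub>T\<^esub> u') w = \<zero>" by simp
    \<comment> \<open>The words of \<open>u'\<close> are shorter than \<open>w\<close>, so no
      cancellation between \<open>?h\<close> and \<open>u'\<close> can occur at
      \<open>w\<close>.\<close>
    moreover have "u' w = \<zero>" using u'(1) by (auto simp: sorted_below_def)
    ultimately show "g w = \<zero>"
      using u'T gT by (simp add: neg_eq homogeneous_component_def)
  qed
  then have "g = \<zero>\<^bsub>T\<^esub>" by auto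
  then show "f \<in> J" using g(2) f T.minus_zero T.r_zero unfolding a_minus_def by metis
qed

end

section \<open>The natural epimorphism\<close>

context free_alg begin

context
  fixes P :: "('i list \<Rightarrow> 'k) set"
  assumes P_sub: "P \<subseteq> carrier T"
begin

abbreviation (input) "N \<equiv> genideal T P"
abbreviation (input) "cl \<equiv> quotient_class k I P"
abbreviation (input) "Q \<equiv> quadratic_algebra k I P"
abbreviation (input) "F \<equiv> induced_filtration k I P"
abbreviation (input) "Gr \<equiv> graded_quadratic_algebra k I P"

text \<open>Taking the classes of all lifts gives the coset of the previous filtration step without
  choosing a representative. As a map on \<open>T\<close> it is the natural epimorphism composed
  with the projection from \<open>T\<close> to the homogeneous version.\<close>

definition symbol :: "('i list \<Rightarrow> 'k) \<Rightarrow> nat \<Rightarrow> ('i list \<Rightarrow> 'k) set set" where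
  "symbol f d = cl ` lifts d f"

lemma ideal_N: "ideal N T"
  by (rule T.genideal_ideal[OF P_sub])

lemma class_hom: "ring_hom_ring T Q cl"
  using ideal.rcos_ring_hom_ring[OF ideal_N]
  by (simp add: quadratic_algebra_def quotient_class_def[abs_def])

interpretation N: ideal N T by (rule ideal_N)
interpretation cl: ring_hom_ring T Q cl by (rule class_hom)

lemma class_eq_iff:
  assumes "f \<in> carrier T" "g \<in> carrier T"
  shows "cl f = cl g \<longleftrightarrow> f \<ominus>\<^bsub>T\<^esub> g \<in> N"
  unfolding quotient_class_def by (rule T.quotient_eq_iff_same_a_r_cos[OF ideal_N assms, symmetric])

lemma previous_step_eq: "previous_step Q F d = symbol \<zero>\<^bsub>T\<^esub> d"
proof (cases d)
  case 0
  have "lifts 0 \<zero>\<^bsub>T\<^esub> = {\<zero>\<^bsub>T\<^esub>}"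
    using T.zero_closed by (auto simp: lifts_def)
  then show ?thesis
    using 0 cl.hom_zero by (simp add: previous_step_def symbol_def del: free_algebra_sel)
next
  case (Suc e)
  have "tensor_filtration k I e = lifts d \<zero>\<^bsub>T\<^esub>"
    unfolding Suc by (fastforce simp: lifts_def tensor_filtration_def Suc_le_eq not_less)
  then show ?thesis by (simp add: previous_step_def symbol_def induced_filtration_def Suc)
qed

text \<open>Translates the cosets in the definition of the graded ring into symbols, whichever lift
  represents them.\<close>

lemma previous_step_coset:
  assumes "f \<in> carrier T" "t \<in> lifts d f"
  shows "previous_step Q F d +>\<^bsub>Q\<^esub> cl t = symbol f d"
proof -
  have t: "t \<in> carrier T" by (rule lifts_carrier[OF assms(2)])
  have "previous_step Q F d +>\<^bsub>Q\<^esub> cl t = (\<lambda>s. cl s \<oplus>\<^bsub>Q\<^esub> cl t) ` lifts d \<zero>\<^bsub>T\<^esub>"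
    by (auto simp: previous_step_eq symbol_def a_r_coset_def' simp del: free_algebra_sel)
  also have "\<dots> = (\<lambda>s. cl (s \<oplus>\<^bsub>T\<^esub> t)) ` lifts d \<zero>\<^bsub>T\<^esub>"
    using t lifts_carrier by (intro image_cong refl) (simp del: free_algebra_sel)
  also have "\<dots> = symbol f d"
    unfolding symbol_def lifts_eq[OF assms] image_image ..
  finally show ?thesis .
qed

lemma symbol_cong: "(\<And>w. length w = d \<Longrightarrow> f w = g w) \<Longrightarrow> symbol f d = symbol g d"
  unfolding symbol_def using lifts_cong by metis

lemma natural_epimorphism_eq:
  assumes "X \<subseteq> carrier T"
  shows "natural_epimorphism k I P X = (\<lambda>d. \<Union>f\<in>X. symbol f d)"
  unfolding natural_epimorphism_def
  using assms by (intro ext SUP_cong refl previous_step_coset component_lifts) auto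

lemma symbol_add:
  assumes "f \<in> carrier T" "g \<in> carrier T"
  shows "symbol f d <+>\<^bsub>Q\<^esub> symbol g d = symbol (f \<oplus>\<^bsub>T\<^esub> g) d"
proof (intro equalityI subsetI)
  fix X assume "X \<in> symbol f d <+>\<^bsub>Q\<^esub> symbol g d"
  then obtain s t where st: "s \<in> lifts d f" "t \<in> lifts d g" "X = cl s \<oplus>\<^bsub>Q\<^esub> cl t"
    by (auto simp: set_add_def' symbol_def)
  then have "X = cl (s \<oplus>\<^bsub>T\<^esub> t)" using lifts_carrier by (simp del: free_algebra_sel)
  then show "X \<in> symbol (f \<oplus>\<^bsub>T\<^esub> g) d" using lifts_add[OF st(1,2)] by (simp add: symbol_def)
next
  fix X assume "X \<in> symbol (f \<oplus>\<^bsub>T\<^esub> g) d"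
  then obtain r where r: "r \<in> lifts d (f \<oplus>\<^bsub>T\<^esub> g)" "X = cl r" by (auto simp: symbol_def)
  let ?g = "homogeneous_component k d g"
  have g: "?g \<in> lifts d g" using assms component_lifts by simp
  \<comment> \<open>A lift of the sum is split by removing the component of \<open>g\<close>, which
    leaves a lift of \<open>f\<close>.\<close>
  have "r \<oplus>\<^bsub>T\<^esub> \<ominus>\<^bsub>T\<^esub> ?g \<in> lifts d ((f \<oplus>\<^bsub>T\<^esub> g) \<oplus>\<^bsub>T\<^esub> \<ominus>\<^bsub>T\<^esub> g)"
    by (intro lifts_add lifts_neg r g assms)
  also have "(f \<oplus>\<^bsub>T\<^esub> g) \<oplus>\<^bsub>T\<^esub> \<ominus>\<^bsub>T\<^esub> g = f"
    using assms by (simp add: T.a_assoc T.r_neg del: free_algebra_sel)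
  finally have s: "r \<oplus>\<^bsub>T\<^esub> \<ominus>\<^bsub>T\<^esub> ?g \<in> lifts d f" .
  have "r = (r \<oplus>\<^bsub>T\<^esub> \<ominus>\<^bsub>T\<^esub> ?g) \<oplus>\<^bsub>T\<^esub> ?g"
    using lifts_carrier[OF r(1)] lifts_carrier[OF g]
    by (simp add: T.a_assoc T.l_neg del: free_algebra_sel)
  then have "X = cl (r \<oplus>\<^bsub>T\<^esub> \<ominus>\<^bsub>T\<^esub> ?g) \<oplus>\<^bsub>Q\<^esub> cl ?g"
    using r(2) lifts_carrier[OF s] lifts_carrier[OF g] cl.hom_add by metis
  then show "X \<in> symbol f d <+>\<^bsub>Q\<^esub> symbol g d"
    using s g by (auto simp: set_add_def' symbol_def)
qed

lemma class_finsum: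
  assumes "h \<in> S \<rightarrow> carrier T"
  shows "cl (finsum T h S) = (\<Oplus>\<^bsub>Q\<^esub>s\<in>S. cl (h s))"
  using cl.hom_finsum[OF assms] by (simp add: comp_def)

text \<open>Independence of representatives: for any choice the sum of products is the class of a
  lift of the product. The union in the multiplication of the graded ring is therefore a union of
  equal sets.\<close>

lemma symbol_mult:
  assumes f: "f \<in> carrier T" and g: "g \<in> carrier T"
    and a: "a \<in> Pi {..d} (symbol f)" and b: "b \<in> Pi {..d} (symbol g)"
  shows "previous_step Q F d +>\<^bsub>Q\<^esub> (\<Oplus>\<^bsub>Q\<^esub>i\<in>{..d}. a i \<otimes>\<^bsub>Q\<^esub> b (d - i)) = symbol (f \<otimes>\<^bsub>T\<^esub> g) d"
proof -
  have "\<exists>s. s \<in> lifts i f \<and> a i = cl s" if "i \<le> d" for i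
  proof -
    have "a i \<in> symbol f i" using a that by (auto simp del: free_algebra_sel)
    then show ?thesis unfolding symbol_def by blast
  qed
  then obtain s where s: "\<And>i. i \<le> d \<Longrightarrow> s i \<in> lifts i f" "\<And>i. i \<le> d \<Longrightarrow> a i = cl (s i)"
    by metis
  have "\<exists>t. t \<in> lifts i g \<and> b i = cl t" if "i \<le> d" for i
  proof -
    have "b i \<in> symbol g i" using b that by (auto simp del: free_algebra_sel)
    then show ?thesis unfolding symbol_def by blast
  qed
  then obtain t where t: "\<And>i. i \<le> d \<Longrightarrow> t i \<in> lifts i g" "\<And>i. i \<le> d \<Longrightarrow> b i = cl (t i)"
    by metis
  have st: "s i \<in> carrier T" "t i \<in> carrier T" if "i \<le> d" for i
    using s(1) t(1) that lifts_carrier by blast+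
  have "(\<Oplus>\<^bsub>Q\<^esub>i\<in>{..d}. a i \<otimes>\<^bsub>Q\<^esub> b (d - i)) = (\<Oplus>\<^bsub>Q\<^esub>i\<in>{..d}. cl (s i \<otimes>\<^bsub>T\<^esub> t (d - i)))"
  proof (rule cl.S.finsum_cong'[OF refl])
    show "(\<lambda>i. cl (s i \<otimes>\<^bsub>T\<^esub> t (d - i))) \<in> {..d} \<rightarrow> carrier Q"
      using st by (intro Pi_I cl.hom_closed T.m_closed) simp_all
    fix i assume "i \<in> {..d}"
    then show "a i \<otimes>\<^bsub>Q\<^esub> b (d - i) = cl (s i \<otimes>\<^bsub>T\<^esub> t (d - i))"
      using s(2)[of i] t(2)[of "d - i"] st(1)[of i] st(2)[of "d - i"] by simp
  qed
  also have "\<dots> = cl (\<Oplus>\<^bsub>T\<^esub>i\<in>{..d}. s i \<otimes>\<^bsub>T\<^esub> t (d - i))"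
    using st by (intro class_finsum[symmetric] Pi_I T.m_closed) simp_all
  finally have eq: "(\<Oplus>\<^bsub>Q\<^esub>i\<in>{..d}. a i \<otimes>\<^bsub>Q\<^esub> b (d - i)) =
    cl (\<Oplus>\<^bsub>T\<^esub>i\<in>{..d}. s i \<otimes>\<^bsub>T\<^esub> t (d - i))" .
  show ?thesis unfolding eq
    by (rule previous_step_coset[OF T.m_closed[OF f g] lifts_mult[OF f g s(1) t(1)]])
qed

lemma symbol_nonempty: "f \<in> carrier T \<Longrightarrow> symbol f d \<noteq> {}"
  using component_lifts by (auto simp: symbol_def)

lemma symbol_hom: "symbol \<in> ring_hom T Gr"
proof (rule ring_hom_memI)
  fix f assume f: "f \<in> carrier T"
  have "\<exists>a\<in>F d. symbol f d = previous_step Q F d +>\<^bsub>Q\<^esub> a" for d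
    using previous_step_coset[OF f component_lifts[OF f]] lifts_filtration[OF component_lifts[OF f]]
    by (force simp: induced_filtration_def)
  moreover have "finite {d. symbol f d \<noteq> previous_step Q F d}"
  proof (rule finite_subset)
    show "finite (length ` {w. f w \<noteq> \<zero>})" using finite_support[OF f] by simp
    show "{d. symbol f d \<noteq> previous_step Q F d} \<subseteq> length ` {w. f w \<noteq> \<zero>}"
    proof
      fix d assume "d \<in> {d. symbol f d \<noteq> previous_step Q F d}"
      then have "symbol f d \<noteq> symbol \<zero>\<^bsub>T\<^esub> d" by (simp add: previous_step_eq)
      then have "\<exists>w. length w = d \<and> f w \<noteq> \<zero>\<^bsub>T\<^esub> w" using symbol_cong by blast
      then show "d \<in> length ` {w. f w \<noteq> \<zero>}" by auto
    qed
  qed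
  ultimately show "symbol f \<in> carrier Gr"
    by (simp add: graded_quadratic_algebra_def associated_graded_def)
next
  fix f g assume f: "f \<in> carrier T" and g: "g \<in> carrier T"
  show "symbol (f \<oplus>\<^bsub>T\<^esub> g) = symbol f \<oplus>\<^bsub>Gr\<^esub> symbol g"
    using symbol_add[OF f g]
    by (simp add: graded_quadratic_algebra_def associated_graded_def fun_eq_iff)
  show "symbol (f \<otimes>\<^bsub>T\<^esub> g) = symbol f \<otimes>\<^bsub>Gr\<^esub> symbol g"
  proof
    fix d
    \<comment> \<open>A union of equal sets equals that set only over a nonempty family of
      representatives.\<close>
    have ne: "Pi {..d} (symbol h) \<noteq> {}" if "h \<in> carrier T" for h
      using symbol_nonempty[OF that] by (simp add: Pi_eq_empty)
    have "(symbol f \<otimes>\<^bsub>Gr\<^esub> symbol g) d =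
        (\<Union>a\<in>Pi {..d} (symbol f). \<Union>b\<in>Pi {..d} (symbol g).
           previous_step Q F d +>\<^bsub>Q\<^esub> (\<Oplus>\<^bsub>Q\<^esub>i\<in>{..d}. a i \<otimes>\<^bsub>Q\<^esub> b (d - i)))"
      by (simp add: graded_quadratic_algebra_def associated_graded_def)
    also have "\<dots> =
        (\<Union>a\<in>Pi {..d} (symbol f). \<Union>b\<in>Pi {..d} (symbol g). symbol (f \<otimes>\<^bsub>T\<^esub> g) d)"
      by (intro SUP_cong refl symbol_mult[OF f g])
    finally have "(symbol f \<otimes>\<^bsub>Gr\<^esub> symbol g) d =
        (\<Union>a\<in>Pi {..d} (symbol f). \<Union>b\<in>Pi {..d} (symbol g). symbol (f \<otimes>\<^bsub>T\<^esub> g) d)" .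
    then show "symbol (f \<otimes>\<^bsub>T\<^esub> g) d = (symbol f \<otimes>\<^bsub>Gr\<^esub> symbol g) d"
      using ne[OF f] ne[OF g] by auto
  qed
next
  show "symbol \<one>\<^bsub>T\<^esub> = \<one>\<^bsub>Gr\<^esub>"
  proof
    fix d
    show "symbol \<one>\<^bsub>T\<^esub> d = \<one>\<^bsub>Gr\<^esub> d"
    proof (cases "d = 0")
      case True
      have "\<one>\<^bsub>T\<^esub> \<in> lifts 0 \<one>\<^bsub>T\<^esub>" using T.one_closed by (auto simp: lifts_def)
      then have "previous_step Q F 0 +>\<^bsub>Q\<^esub> cl \<one>\<^bsub>T\<^esub> = symbol \<one>\<^bsub>T\<^esub> 0"
        by (rule previous_step_coset[OF T.one_closed])
      then show ?thesis unfolding cl.hom_one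
        by (simp add: graded_quadratic_algebra_def associated_graded_def True del: free_algebra_sel)
    next
      case False
      then have "symbol \<one>\<^bsub>T\<^esub> d = symbol \<zero>\<^bsub>T\<^esub> d" by (intro symbol_cong) auto
      then show ?thesis
        by (simp add: graded_quadratic_algebra_def associated_graded_def False previous_step_eq
            del: free_algebra_sel)
    qed
  qed
qed

section \<open>The graded ring as an image of the free algebra\<close>

lemma symbol_zero: "symbol \<zero>\<^bsub>T\<^esub> = \<zero>\<^bsub>Gr\<^esub>"
  by (simp add: graded_quadratic_algebra_def associated_graded_def fun_eq_iff previous_step_eq
      del: free_algebra_sel)

lemma symbol_surj: "symbol ` carrier T = carrier Gr"
proof (intro equalityI subsetI)
  fix g assume "g \<in> symbol ` carrier T"
  then show "g \<in> carrier Gr" using symbol_hom ring_hom_closed by fastforce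
next
  fix g assume "g \<in> carrier Gr"
  then have ex: "\<And>d. \<exists>a\<in>F d. g d = previous_step Q F d +>\<^bsub>Q\<^esub> a"
    and fin: "finite {d. g d \<noteq> previous_step Q F d}"
    by (auto simp: graded_quadratic_algebra_def associated_graded_def)
  \<comment> \<open>The representative of a trivial coset is required to be zero; otherwise gluing
    the representatives could produce infinite support.\<close>
  have "\<exists>t\<in>carrier T. g d = symbol t d \<and> (g d = previous_step Q F d \<longrightarrow> t = \<zero>\<^bsub>T\<^esub>)" for d
  proof (cases "g d = previous_step Q F d")
    case True
    then show ?thesis using T.zero_closed previous_step_eq by blast
  next
    case False
    obtain t where t: "t \<in> tensor_filtration k I d" "g d = previous_step Q F d +>\<^bsub>Q\<^esub> cl t"
      using ex[of d] by (auto simp: induced_filtration_def)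
    have tT: "t \<in> carrier T" using t(1) by (simp add: tensor_filtration_def)
    then show ?thesis using False t(2) previous_step_coset[OF tT lifts_self[OF t(1)]] by metis
  qed
  then obtain t where t: "\<And>d. t d \<in> carrier T" "\<And>d. g d = symbol (t d) d"
    "\<And>d. g d = previous_step Q F d \<Longrightarrow> t d = \<zero>\<^bsub>T\<^esub>"
    by metis
  \<comment> \<open>The words of length \<open>d\<close> are read off from the representative chosen
    in degree \<open>d\<close>; its lower terms do not affect the coset.\<close>
  define f where "f w = t (length w) w" for w
  have "f \<in> carrier T"
  proof (rule free_algebraI)
    show "finite (\<Union>d\<in>{d. g d \<noteq> previous_step Q F d}. {w. t d w \<noteq> \<zero>})"
      using fin t(1) finite_support by blast
    fix w show "f w \<in> carrier k" using t(1) by (simp add: f_def)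
    assume nz: "f w \<noteq> \<zero>"
    then have "t (length w) \<noteq> \<zero>\<^bsub>T\<^esub>" by (auto simp: f_def)
    then have "g (length w) \<noteq> previous_step Q F (length w)" using t(3) by blast
    then show "w \<in> (\<Union>d\<in>{d. g d \<noteq> previous_step Q F d}. {w. t d w \<noteq> \<zero>})"
      using nz by (auto simp: f_def)
    show "w \<in> lists I" using nz t(1) support_lists unfolding f_def by blast
  qed
  moreover have "symbol f = g"
  proof
    fix d show "symbol f d = g d"
      unfolding t(2) by (rule symbol_cong) (simp add: f_def)
  qed
  ultimately show "g \<in> symbol ` carrier T" by blast
qed

text \<open>The image of a ring under a map that respects the operations is a ring, which spares a
  check of the axioms on families of cosets.\<close>

lemma ring_graded: "ring Gr"
  using T.ring_hom_imp_img_ring[OF symbol_hom] unfolding symbol_surj symbol_zero by simp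

lemma symbol_ring_hom: "ring_hom_ring T Gr symbol"
  by (intro ring_hom_ringI2 ring_free_algebra ring_graded symbol_hom)

text \<open>A coset in degree \<open>d\<close> is trivial exactly when the component agrees modulo
  \<open>N\<close> with something of lower degree, and their difference is the required lift in
  \<open>N\<close>.\<close>

lemma symbol_eq_zero_iff:
  assumes f: "f \<in> carrier T"
  shows "symbol f = \<zero>\<^bsub>Gr\<^esub> \<longleftrightarrow> f \<in> leading_ideal N"
proof
  assume eq: "symbol f = \<zero>\<^bsub>Gr\<^esub>"
  show "f \<in> leading_ideal N"
  proof (rule leading_idealI[OF f])
    fix d
    let ?f = "homogeneous_component k d f"
    have "cl ?f \<in> symbol f d" using component_lifts[OF f] by (simp add: symbol_def)
    then have "cl ?f \<in> symbol \<zero>\<^bsub>T\<^esub> d" using eq symbol_zero by metis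
    then obtain t where t: "t \<in> lifts d \<zero>\<^bsub>T\<^esub>" "cl ?f = cl t" by (auto simp: symbol_def)
    \<comment> \<open>\<open>t\<close> has degree below \<open>d\<close>, so subtracting it moves
      the component into \<open>N\<close> without changing degree \<open>d\<close>.\<close>
    have "?f \<oplus>\<^bsub>T\<^esub> \<ominus>\<^bsub>T\<^esub> t \<in> lifts d (f \<oplus>\<^bsub>T\<^esub> \<ominus>\<^bsub>T\<^esub> \<zero>\<^bsub>T\<^esub>)"
      using component_lifts[OF f] lifts_neg[OF T.zero_closed t(1)] by (rule lifts_add)
    moreover have "f \<oplus>\<^bsub>T\<^esub> \<ominus>\<^bsub>T\<^esub> \<zero>\<^bsub>T\<^esub> = f" using f T.minus_zero T.r_zero by metis
    moreover have "?f \<ominus>\<^bsub>T\<^esub> t \<in> N"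
      using t class_eq_iff component_carrier[OF f] lifts_carrier by blast
    ultimately show "\<exists>s. s \<in> N \<and> s \<in> lifts d f" unfolding a_minus_def by metis
  qed
next
  assume "f \<in> leading_ideal N"
  then obtain t where t: "\<And>d. t d \<in> N" "\<And>d. t d \<in> lifts d f" using leading_idealE by metis
  have "symbol f d = symbol \<zero>\<^bsub>T\<^esub> d" for d
  proof -
    have "cl (t d) = cl \<zero>\<^bsub>T\<^esub>"
      using t(1)[of d] lifts_carrier[OF t(2)] class_eq_iff[OF _ T.zero_closed]
      by (simp add: T.minus_eq T.minus_zero del: free_algebra_sel)
    moreover have "\<zero>\<^bsub>T\<^esub> \<in> lifts d \<zero>\<^bsub>T\<^esub>" using T.zero_closed by (auto simp: lifts_def)
    ultimately show ?thesis
      using previous_step_coset[OF f t(2)[of d]] previous_step_coset[OF T.zero_closed] by metis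
  qed
  then show "symbol f = \<zero>\<^bsub>Gr\<^esub>" unfolding symbol_zero[symmetric] by (rule ext)
qed

end

text \<open>The hypothesis \<open>leading\<close> identifies the kernel of the symbol map with the
  ideal of the homogeneous version; the reverse inclusion is automatic. The first isomorphism
  theorem then gives the isomorphism.\<close>

theorem PBW_deformationI:
  assumes P: "submodule P k T" "P \<subseteq> tensor_filtration k I 2"
    and leading: "leading_ideal (genideal T P) \<subseteq> genideal T (homogeneous_component k 2 ` P)"
  shows "PBW_deformation k I P"
proof -
  let ?Gr = "graded_quadratic_algebra k I P" and ?p = "\<lambda>X. the_elem (symbol P ` X)"
  have PT: "P \<subseteq> carrier T" using P(2) by (auto simp: tensor_filtration_def)
  interpret symbol: ring_hom_ring T ?Gr "symbol P" by (rule symbol_ring_hom[OF PT])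
  have "a_kernel T ?Gr (symbol P) = leading_ideal (genideal T P)"
    unfolding a_kernel_def' using symbol_eq_zero_iff[OF PT] by (auto simp: leading_ideal_def)
  also have "\<dots> = genideal T (homogeneous_component k 2 ` P)"
    using leading genideal_components_leading[OF P(2)] by blast
  finally have kernel: "T Quot a_kernel T ?Gr (symbol P) = homogeneous_version k I P"
    by (simp add: homogeneous_version_def quadratic_algebra_def)
  have iso: "?p \<in> ring_iso (homogeneous_version k I P) ?Gr"
    using symbol.FactRing_iso_set[OF symbol_surj[OF PT]] unfolding kernel .
  \<comment> \<open>The symbol is constant on a coset of its kernel, so \<open>the_elem\<close> and
    the union in \<open>natural_epimorphism\<close> both return that constant value.\<close>
  have eq: "?p X = natural_epimorphism k I P X" if X: "X \<in> carrier (homogeneous_version k I P)" for X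
  proof -
    obtain z where z: "symbol P ` X = {z}"
      using symbol.the_elem_wf[of X] X unfolding kernel by blast
    have "X \<noteq> {}" using z by auto
    have "X \<subseteq> carrier T"
    proof -
      interpret K: ideal "a_kernel T ?Gr (symbol P)" T by (rule symbol.kernel_is_ideal)
      show ?thesis
        using X K.a_rcosets_carrier unfolding kernel[symmetric] by (simp add: FactRing_def)
    qed
    then have "natural_epimorphism k I P X = (\<lambda>d. \<Union>f\<in>X. symbol P f d)"
      using natural_epimorphism_eq[OF PT] by blast
    moreover have "symbol P f = z" if "f \<in> X" for f using z that by blast
    ultimately have "natural_epimorphism k I P X = z" using \<open>X \<noteq> {}\<close> by auto
    then show ?thesis using z by simp
  qed
  have "ring (homogeneous_version k I P)"
    using ideal.quotient_is_ring[OF symbol.kernel_is_ideal] unfolding kernel .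
  then have "natural_epimorphism k I P \<in> ring_iso (homogeneous_version k I P) ?Gr"
    by (rule ring.ring_iso_restrict[OF _ iso eq])
  then show ?thesis using P by (simp add: PBW_deformation_def)
qed

end

section \<open>Evaluation at central scalars\<close>

locale central_evaluation = ring A for A :: "('a, 'm) ring_scheme" (structure) +
  fixes K :: "'a set" and I :: "'i set" and x :: "'i \<Rightarrow> 'a"
  assumes subcring_K: "subcring K A"
    and x_closed: "i \<in> I \<Longrightarrow> x i \<in> carrier A"
    and x_central: "i \<in> I \<Longrightarrow> r \<in> K \<Longrightarrow> x i \<otimes> r = r \<otimes> x i"
begin

lemma K_subset: "K \<subseteq> carrier A"
  using subcring_K by (simp add: subcring.axioms(1) subringE(1))

lemma cring_K: "cring (A\<lparr>carrier := K\<rparr>)"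
  using subcring_iff[OF K_subset] subcring_K by blast

end

text \<open>Cutting the carrier down to \<open>K\<close> keeps addition and multiplication, so
  coefficients are elements of \<open>A\<close> as they stand and no embedding is required.\<close>

sublocale central_evaluation \<subseteq> free: free_alg "A\<lparr>carrier := K\<rparr>" I
  by (simp add: free_alg_def cring_K)

context central_evaluation begin

section \<open>Evaluation as a ring homomorphism\<close>

abbreviation word_value :: "'i list \<Rightarrow> 'a" where
  "word_value w \<equiv> list_product A (map x w)"

abbreviation ev :: "('i list \<Rightarrow> 'a) \<Rightarrow> 'a" where
  "ev \<equiv> free_value A x"

lemma coeff_K: "f \<in> carrier free.T \<Longrightarrow> f w \<in> K"
  using free.coeff_closed by simp

lemma coeff_A: "f \<in> carrier free.T \<Longrightarrow> f w \<in> carrier A"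
  using coeff_K K_subset by blast

lemma list_product_Nil [simp]: "list_product A [] = \<one>"
  by (simp add: list_product_def)

lemma list_product_Cons [simp]: "list_product A (a # as) = a \<otimes> list_product A as"
  by (simp add: list_product_def)

lemma word_value_closed [simp]: "w \<in> lists I \<Longrightarrow> word_value w \<in> carrier A"
  by (induction w) (auto simp: x_closed)

lemma word_value_append:
  "u \<in> lists I \<Longrightarrow> v \<in> lists I \<Longrightarrow> word_value (u @ v) = word_value u \<otimes> word_value v"
  by (induction u) (auto simp: x_closed m_assoc)

text \<open>In a product of two monomials the scalar of the right factor has to pass the word of the
  left one; constancy of the extension permits this.\<close>

lemma word_value_central:
  assumes "w \<in> lists I" "r \<in> K"
  shows "word_value w \<otimes> r = r \<otimes> word_value w"
  using assms(1)
proof (induction w)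
  case Nil
  then show ?case using assms(2) K_subset by auto
next
  case (Cons i w)
  have r: "r \<in> carrier A" using assms(2) K_subset by blast
  have "x i \<otimes> word_value w \<otimes> r = x i \<otimes> (r \<otimes> word_value w)"
    using Cons r x_closed by (simp add: m_assoc)
  also have "\<dots> = x i \<otimes> r \<otimes> word_value w"
    using Cons.hyps r x_closed by (simp add: m_assoc)
  also have "\<dots> = r \<otimes> (x i \<otimes> word_value w)"
    using Cons.hyps r x_closed x_central assms(2) by (simp add: m_assoc)
  finally show ?case by simp
qed

text \<open>\<open>free_value\<close> sums over the exact support, which changes under addition; a
  common finite superset makes the sums comparable.\<close>

lemma ev_superset:
  assumes "f \<in> carrier free.T" "finite S" "S \<subseteq> lists I" "{w. f w \<noteq> \<zero>} \<subseteq> S"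
  shows "ev f = (\<Oplus>w\<in>S. f w \<otimes> word_value w)"
  unfolding free_value_def
proof (rule add.finprod_mono_neutral_cong_left)
  fix w assume "w \<in> S - {w. f w \<noteq> \<zero>}"
  then have "w \<in> lists I" "f w = \<zero>" using assms(3) by blast+
  then show "f w \<otimes> word_value w = \<zero>" by simp
next
  show "(\<lambda>w. f w \<otimes> word_value w) \<in> S \<rightarrow> carrier A"
    using assms(1,3) coeff_A by (intro Pi_I m_closed word_value_closed) auto
qed (use assms in auto)

lemma finite_support_A: "f \<in> carrier free.T \<Longrightarrow> finite {w. f w \<noteq> \<zero>}"
  using free.finite_support by simp

lemma support_lists_A: "f \<in> carrier free.T \<Longrightarrow> f w \<noteq> \<zero> \<Longrightarrow> w \<in> lists I"
  using free.support_lists by simp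

lemma ev_closed:
  assumes "f \<in> carrier free.T"
  shows "ev f \<in> carrier A"
  unfolding free_value_def
  using assms coeff_A support_lists_A
  by (intro finsum_closed Pi_I m_closed word_value_closed) auto

lemma ev_add:
  assumes f: "f \<in> carrier free.T" and g: "g \<in> carrier free.T"
  shows "ev (f \<oplus>\<^bsub>free.T\<^esub> g) = ev f \<oplus> ev g"
proof -
  let ?S = "{w. f w \<noteq> \<zero>} \<union> {w. g w \<noteq> \<zero>}"
  have S: "finite ?S" "?S \<subseteq> lists I"
    using f g finite_support_A support_lists_A by auto
  have "ev (f \<oplus>\<^bsub>free.T\<^esub> g) = (\<Oplus>w\<in>?S. (f w \<oplus> g w) \<otimes> word_value w)"
    using free.T.a_closed[OF f g] S by (subst ev_superset[OF _ S]) auto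
  also have "\<dots> = (\<Oplus>w\<in>?S. f w \<otimes> word_value w \<oplus> g w \<otimes> word_value w)"
  proof (rule finsum_cong'[OF refl])
    fix w assume "w \<in> ?S"
    then have "w \<in> lists I" using S by blast
    then show "(f w \<oplus> g w) \<otimes> word_value w = f w \<otimes> word_value w \<oplus> g w \<otimes> word_value w"
      using coeff_A[OF f] coeff_A[OF g] by (simp add: l_distr)
  qed (use S coeff_A[OF f] coeff_A[OF g] in \<open>intro Pi_I a_closed m_closed word_value_closed; blast\<close>)
  also have "\<dots> = (\<Oplus>w\<in>?S. f w \<otimes> word_value w) \<oplus> (\<Oplus>w\<in>?S. g w \<otimes> word_value w)"
    using S coeff_A[OF f] coeff_A[OF g]
    by (intro finsum_addf Pi_I m_closed word_value_closed) blast+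
  also have "\<dots> = ev f \<oplus> ev g"
    using ev_superset[OF f S] ev_superset[OF g S] by simp
  finally show ?thesis .
qed

lemma ev_monom:
  assumes a: "a \<in> K" and w: "w \<in> lists I"
  shows "ev (free.monomial a w) = a \<otimes> word_value w"
proof -
  have "ev (free.monomial a w) = (\<Oplus>v\<in>{w}. free.monomial a w v \<otimes> word_value v)"
    using assms by (intro ev_superset free.monom_carrier) (auto simp: free.monomial_def)
  also have "\<dots> = a \<otimes> word_value w"
    using subsetD[OF K_subset a] w by (subst finsum_insert) (auto simp: free.monomial_def)
  finally show ?thesis .
qed

lemma ev_zero: "ev \<zero>\<^bsub>free.T\<^esub> = \<zero>"
  by (simp add: free_value_def)

text \<open>Multiplicativity is obtained one factor at a time: additivity reduces the right factor
  to a monomial here, and the left factor in \<open>ev_mult\<close>.\<close>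

lemma ev_monom_mult:
  assumes a: "a \<in> K" and u: "u \<in> lists I" and g: "g \<in> carrier free.T"
  shows "ev (free.monomial a u \<otimes>\<^bsub>free.T\<^esub> g) = ev (free.monomial a u) \<otimes> ev g"
proof -
  have mT: "free.monomial a u \<in> carrier free.T" using a u by simp
  have aA: "a \<in> carrier A" using a K_subset by blast
  show ?thesis using g
  proof (induction rule: free.free_algebra_induct)
    case zero
    show ?case using free.T.r_null[OF mT] ev_closed[OF mT] ev_zero
      by (simp del: free.free_algebra_sel)
  next
    case (add h b v)
    have b: "b \<in> K" and v: "v \<in> lists I" and h: "h \<in> carrier free.T" using add.hyps by simp_all
    have bA: "b \<in> carrier A" using b K_subset by blast
    have bT: "free.monomial b v \<in> carrier free.T" using b v by simp
    have mm: "free.monomial a u \<otimes>\<^bsub>free.T\<^esub> free.monomial b v = free.monomial (a \<otimes> b) (u @ v)"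
      using free.mult_monom_monom[of a b u v] a b u v by simp
    have ab: "a \<otimes> b \<in> K" using cring.cring_simprules(5)[OF cring_K, of a b] a b by simp
    have "ev (free.monomial a u \<otimes>\<^bsub>free.T\<^esub> free.monomial b v) = a \<otimes> (b \<otimes> word_value u) \<otimes> word_value v"
      unfolding mm using ab u v aA bA
      by (simp add: ev_monom word_value_append m_assoc del: map_append)
    also have "\<dots> = a \<otimes> (word_value u \<otimes> b) \<otimes> word_value v"
      using word_value_central[OF u b] by simp
    also have "\<dots> = ev (free.monomial a u) \<otimes> ev (free.monomial b v)"
      using aA bA a b u v by (simp add: ev_monom m_assoc)
    finally have eq: "ev (free.monomial a u \<otimes>\<^bsub>free.T\<^esub> free.monomial b v) =
        ev (free.monomial a u) \<otimes> ev (free.monomial b v)" .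
    show ?case
      unfolding free.T.r_distr[OF h bT mT] ev_add[OF free.T.m_closed[OF mT h] free.T.m_closed[OF mT bT]]
        ev_add[OF h bT] add.IH eq
      using ev_closed[OF mT] ev_closed[OF h] ev_closed[OF bT] by (simp add: r_distr)
  qed
qed

lemma ev_mult:
  assumes f: "f \<in> carrier free.T" and g: "g \<in> carrier free.T"
  shows "ev (f \<otimes>\<^bsub>free.T\<^esub> g) = ev f \<otimes> ev g"
  using f
proof (induction rule: free.free_algebra_induct)
  case zero
  show ?case using free.T.l_null[OF g] ev_closed[OF g] ev_zero
    by (simp del: free.free_algebra_sel)
next
  case (add h b v)
  have bT: "free.monomial b v \<in> carrier free.T" using add.hyps by simp
  have eq: "ev (free.monomial b v \<otimes>\<^bsub>free.T\<^esub> g) = ev (free.monomial b v) \<otimes> ev g"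
    using add.hyps g by (intro ev_monom_mult) simp_all
  show ?case
    unfolding free.T.l_distr[OF add.hyps(1) bT g]
      ev_add[OF free.T.m_closed[OF add.hyps(1) g] free.T.m_closed[OF bT g]]
      ev_add[OF add.hyps(1) bT] add.IH eq
    using ev_closed[OF g] ev_closed[OF add.hyps(1)] ev_closed[OF bT] by (simp add: l_distr)
qed

lemma ev_one: "ev \<one>\<^bsub>free.T\<^esub> = \<one>"
  using ev_monom[of \<one> "[]"] free.one_closed unfolding free.one_eq by simp

lemma ev_hom: "ring_hom_ring free.T A ev"
  by (intro ring_hom_ringI2 free.ring_free_algebra ring_axioms ring_hom_memI)
    (simp_all add: ev_closed ev_mult ev_add ev_one del: free.free_algebra_sel)

end

section \<open>Sorted words and standard monomials\<close>

definition sorted_word :: "nat \<Rightarrow> (nat \<Rightarrow> nat) \<Rightarrow> nat list" where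
  "sorted_word n \<alpha> = concat (map (\<lambda>i. replicate (\<alpha> i) i) [1..<Suc n])"

text \<open>\<open>restrict\<close> makes the result extensional, as the multi-indices that index
  the basis are.\<close>

definition exponents :: "nat \<Rightarrow> nat list \<Rightarrow> nat \<Rightarrow> nat" where
  "exponents n w = restrict (count_list w) {1..n}"

lemma sorted_word_Suc:
  "sorted_word (Suc n) \<alpha> = sorted_word n \<alpha> @ replicate (\<alpha> (Suc n)) (Suc n)"
  by (simp add: sorted_word_def)

lemma set_sorted_word: "set (sorted_word n \<alpha>) \<subseteq> {1..n}"
  by (auto simp: sorted_word_def)

lemma sorted_sorted_word: "sorted (sorted_word n \<alpha>)"
proof (induction n)
  case (Suc n)
  then show ?case using set_sorted_word[of n \<alpha>]
    by (fastforce simp: sorted_word_Suc sorted_append sorted_replicate)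
qed (simp add: sorted_word_def)

lemma count_sorted_word: "count_list (sorted_word n \<alpha>) i = (if i \<in> {1..n} then \<alpha> i else 0)"
proof (induction n)
  case (Suc n)
  have "count_list (replicate m (j :: nat)) i = (if i = j then m else 0)" for m j
    by (induction m) auto
  with Suc show ?case by (auto simp: sorted_word_Suc le_Suc_eq)
qed (simp add: sorted_word_def)

lemma exponents_sorted_word:
  "\<alpha> \<in> {1..n} \<rightarrow>\<^sub>E UNIV \<Longrightarrow> exponents n (sorted_word n \<alpha>) = \<alpha>"
  by (rule ext) (auto simp: exponents_def count_sorted_word PiE_def extensional_def)

text \<open>A sorted word is determined by the multiset of its letters, and both words have the same
  letter counts.\<close>

lemma sorted_word_exponents:
  assumes "sorted w" "w \<in> lists {1..n}"
  shows "sorted_word n (exponents n w) = w"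
proof -
  have "count_list (sorted_word n (exponents n w)) i = count_list w i" for i
    using assms(2) by (auto simp: count_sorted_word exponents_def count_list_0_iff)
  then have "mset (sorted_word n (exponents n w)) = mset w"
    by (intro multiset_eqI) (simp add: count_mset)
  then show ?thesis
    using properties_for_sort sorted_sorted_word assms(1) by (metis sorted_sort_id)
qed

lemma bij_betw_sorted_word:
  "bij_betw (sorted_word n) ({1..n} \<rightarrow>\<^sub>E UNIV) {w \<in> lists {1..n}. sorted w}"
proof (rule bij_betw_byWitness[where f' = "exponents n"])
  show "\<forall>\<alpha>\<in>{1..n} \<rightarrow>\<^sub>E UNIV. exponents n (sorted_word n \<alpha>) = \<alpha>"
    using exponents_sorted_word by blast
  show "\<forall>w\<in>{w \<in> lists {1..n}. sorted w}. sorted_word n (exponents n w) = w"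
    using sorted_word_exponents by blast
  show "sorted_word n ` ({1..n} \<rightarrow>\<^sub>E UNIV) \<subseteq> {w \<in> lists {1..n}. sorted w}"
    using set_sorted_word sorted_sorted_word by fastforce
  show "exponents n ` {w \<in> lists {1..n}. sorted w} \<subseteq> {1..n} \<rightarrow>\<^sub>E UNIV"
    by (auto simp: exponents_def)
qed

locale skew_extension =
  fixes A :: "('a, 'm) ring_scheme" (structure) and K :: "'a set" and n :: nat
    and x :: "nat \<Rightarrow> 'a" and c :: "nat \<Rightarrow> nat \<Rightarrow> 'a"
  assumes skew: "skew_PBW_extension A K n x"
    and const: "constant_extension A K n x"
    and constants: "commutation_constants A K n x c"

sublocale skew_extension \<subseteq> central_evaluation A K "{1..n}" x
proof -
  have sub: "subfield K A" and A: "ring A" and x: "x \<in> {1..n} \<rightarrow> carrier A"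
    using skew by (simp_all add: skew_PBW_extension_def)
  show "central_evaluation A K {1..n} x"
  proof (intro central_evaluation.intro central_evaluation_axioms.intro A)
    show "subcring K A" by (rule subdomain.axioms(1)[OF subfield.axioms(1)[OF sub]])
    show "x i \<in> carrier A" if "i \<in> {1..n}" for i using x that by blast
    show "x i \<otimes> r = r \<otimes> x i" if "i \<in> {1..n}" "r \<in> K" for i r
      using const that unfolding constant_extension_def by blast
  qed
qed

context skew_extension begin

abbreviation multi_indices :: "(nat \<Rightarrow> nat) set" where
  "multi_indices \<equiv> {1..n} \<rightarrow>\<^sub>E UNIV"

lemma sorted_word_lists: "sorted_word n \<alpha> \<in> lists {1..n}"
  using set_sorted_word by blast

lemma word_value_replicate: "i \<in> {1..n} \<Longrightarrow> word_value (replicate m i) = x i [^] m"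
proof (induction m)
  case (Suc m)
  then show ?case using nat_pow_Suc2[OF x_closed[OF Suc.prems], of m] by simp
qed simp

lemma word_value_sorted_word: "word_value (sorted_word n \<alpha>) = standard_monomial A n x \<alpha>"
proof -
  \<comment> \<open>Stated for an arbitrary list of indices, so that induction on the list is
    possible.\<close>
  have "word_value (concat (map (\<lambda>i. replicate (\<alpha> i) i) is)) =
      list_product A (map (\<lambda>i. x i [^] \<alpha> i) is)" if "set is \<subseteq> {1..n}" for "is"
    using that
  proof (induction "is")
    case (Cons i "is")
    have "replicate (\<alpha> i) i \<in> lists {1..n}" "concat (map (\<lambda>i. replicate (\<alpha> i) i) is) \<in> lists {1..n}"
      using Cons.prems by auto
    from word_value_append[OF this] show ?case
      using Cons word_value_replicate[of i "\<alpha> i"] by simp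
  qed simp
  moreover have "set [1..<Suc n] \<subseteq> {1..n}" by auto
  ultimately show ?thesis unfolding sorted_word_def standard_monomial_def by blast
qed

section \<open>Sorted polynomials and the basis of standard monomials\<close>

lemma basis: "left_module_basis A K multi_indices (standard_monomial A n x)"
  using skew by (simp add: skew_PBW_extension_def)

lemma basis_expansion:
  assumes "a \<in> carrier A"
  shows "\<exists>!f. f \<in> multi_indices \<rightarrow>\<^sub>E K \<and> finite {\<alpha> \<in> multi_indices. f \<alpha> \<noteq> \<zero>} \<and>
    a = (\<Oplus>\<alpha>\<in>{\<alpha> \<in> multi_indices. f \<alpha> \<noteq> \<zero>}. f \<alpha> \<otimes> standard_monomial A n x \<alpha>)"
  using basis assms unfolding left_module_basis_def by blast

lemma support_sorted:
  assumes "g \<in> carrier free.T" "\<forall>w. g w \<noteq> \<zero> \<longrightarrow> sorted w"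
  shows "{w. g w \<noteq> \<zero>} = sorted_word n ` {\<alpha> \<in> multi_indices. g (sorted_word n \<alpha>) \<noteq> \<zero>}"
proof (intro equalityI subsetI)
  fix w assume "w \<in> {w. g w \<noteq> \<zero>}"
  then have w: "g w \<noteq> \<zero>" "w \<in> {w \<in> lists {1..n}. sorted w}"
    using assms support_lists_A by blast+
  then obtain \<alpha> where "\<alpha> \<in> multi_indices" "w = sorted_word n \<alpha>"
    using bij_betw_imp_surj_on[OF bij_betw_sorted_word] by blast
  then show "w \<in> sorted_word n ` {\<alpha> \<in> multi_indices. g (sorted_word n \<alpha>) \<noteq> \<zero>}"
    using w(1) by blast
qed auto

lemma inj_on_sorted_word: "S \<subseteq> multi_indices \<Longrightarrow> inj_on (sorted_word n) S"
  using bij_betw_imp_inj_on[OF bij_betw_sorted_word] by (rule inj_on_subset)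

lemma ev_sorted:
  assumes g: "g \<in> carrier free.T" "\<forall>w. g w \<noteq> \<zero> \<longrightarrow> sorted w"
  shows "finite {\<alpha> \<in> multi_indices. g (sorted_word n \<alpha>) \<noteq> \<zero>}"
    and "ev g = (\<Oplus>\<alpha>\<in>{\<alpha> \<in> multi_indices. g (sorted_word n \<alpha>) \<noteq> \<zero>}.
                  g (sorted_word n \<alpha>) \<otimes> standard_monomial A n x \<alpha>)"
proof -
  let ?S = "{\<alpha> \<in> multi_indices. g (sorted_word n \<alpha>) \<noteq> \<zero>}"
  have inj: "inj_on (sorted_word n) ?S" by (rule inj_on_sorted_word) blast
  have "finite (sorted_word n ` ?S)"
    using finite_support_A[OF g(1)] unfolding support_sorted[OF g] .
  then show "finite ?S" using inj by (rule finite_imageD)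
  have "ev g = (\<Oplus>w\<in>sorted_word n ` ?S. g w \<otimes> word_value w)"
    unfolding free_value_def support_sorted[OF g] ..
  also have "\<dots> = (\<Oplus>\<alpha>\<in>?S. g (sorted_word n \<alpha>) \<otimes> word_value (sorted_word n \<alpha>))"
    using coeff_A[OF g(1)] sorted_word_lists word_value_closed inj
    by (intro finsum_reindex) blast+
  finally show "ev g = (\<Oplus>\<alpha>\<in>?S. g (sorted_word n \<alpha>) \<otimes> standard_monomial A n x \<alpha>)"
    unfolding word_value_sorted_word .
qed

lemma zero_K: "\<zero> \<in> K"
  using free.zero_closed by simp

text \<open>The coefficients of \<open>g\<close> and the zero family both expand zero in the
  standard monomials, so uniqueness of the expansion identifies them.\<close>

lemma sorted_independent:
  assumes g: "g \<in> carrier free.T" "\<forall>w. g w \<noteq> \<zero> \<longrightarrow> sorted w" and ev0: "ev g = \<zero>"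
  shows "g = \<zero>\<^bsub>free.T\<^esub>"
proof -
  \<comment> \<open>Uniqueness holds among extensional families only, so both candidates are
    restricted to the multi-indices.\<close>
  let ?f = "restrict (\<lambda>\<alpha>. g (sorted_word n \<alpha>)) multi_indices" and ?z = "restrict (\<lambda>\<alpha>. \<zero>) multi_indices"
  have supp: "{\<alpha> \<in> multi_indices. ?f \<alpha> \<noteq> \<zero>} = {\<alpha> \<in> multi_indices. g (sorted_word n \<alpha>) \<noteq> \<zero>}"
    by (intro Collect_cong conj_cong refl) simp
  have suppz: "{\<alpha> \<in> multi_indices. ?z \<alpha> \<noteq> \<zero>} = {}" by auto
  have "ev g = (\<Oplus>\<alpha>\<in>{\<alpha> \<in> multi_indices. ?f \<alpha> \<noteq> \<zero>}. ?f \<alpha> \<otimes> standard_monomial A n x \<alpha>)"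
    unfolding supp ev_sorted(2)[OF g]
    using coeff_A[OF g(1)] word_value_closed[OF sorted_word_lists]
    by (intro finsum_cong' refl) (auto simp flip: word_value_sorted_word)
  moreover have "finite {\<alpha> \<in> multi_indices. ?f \<alpha> \<noteq> \<zero>}"
    unfolding supp by (rule ev_sorted(1)[OF g])
  moreover have "?f \<in> multi_indices \<rightarrow>\<^sub>E K" using coeff_K[OF g(1)] by simp
  moreover have "?z \<in> multi_indices \<rightarrow>\<^sub>E K" using zero_K by simp
  moreover have "\<zero> = (\<Oplus>\<alpha>\<in>{\<alpha> \<in> multi_indices. ?z \<alpha> \<noteq> \<zero>}. ?z \<alpha> \<otimes> standard_monomial A n x \<alpha>)"
    unfolding suppz by simp
  moreover have "finite {\<alpha> \<in> multi_indices. ?z \<alpha> \<noteq> \<zero>}" unfolding suppz by simp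
  ultimately have fz: "?f = ?z" unfolding ev0 using basis_expansion[OF zero_closed] by blast
  have "{\<alpha> \<in> multi_indices. g (sorted_word n \<alpha>) \<noteq> \<zero>} = {}"
    unfolding supp[symmetric] fz by auto
  then have "{w. g w \<noteq> \<zero>} = {}" unfolding support_sorted[OF g] by blast
  then show ?thesis unfolding free.free_algebra_sel by (simp add: fun_eq_iff)
qed

lemma ev_surj: "ev ` carrier free.T = carrier A"
proof (intro equalityI subsetI)
  fix a assume "a \<in> carrier A"
  then obtain f where f: "f \<in> multi_indices \<rightarrow>\<^sub>E K" "finite {\<alpha> \<in> multi_indices. f \<alpha> \<noteq> \<zero>}"
    "a = (\<Oplus>\<alpha>\<in>{\<alpha> \<in> multi_indices. f \<alpha> \<noteq> \<zero>}. f \<alpha> \<otimes> standard_monomial A n x \<alpha>)"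
    using basis_expansion by blast
  \<comment> \<open>The basis expansion of \<open>a\<close>, written as a polynomial supported on
    sorted words.\<close>
  define g where "g w = (if w \<in> lists {1..n} \<and> sorted w then f (exponents n w) else \<zero>)" for w
  have fK: "f \<alpha> \<in> K" if "\<alpha> \<in> multi_indices" for \<alpha> using f(1) that by blast
  have ex: "exponents n w \<in> multi_indices" for w by (simp add: exponents_def)
  have g_sorted: "g (sorted_word n \<alpha>) = f \<alpha>" if "\<alpha> \<in> multi_indices" for \<alpha>
    using sorted_word_lists sorted_sorted_word exponents_sorted_word[OF that] by (simp add: g_def)
  have g: "g \<in> carrier free.T"
  proof (rule free.free_algebraI)
    show "finite (sorted_word n ` {\<alpha> \<in> multi_indices. f \<alpha> \<noteq> \<zero>})" using f(2) by simp
    fix w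
    show "g w \<in> carrier (A\<lparr>carrier := K\<rparr>)" using fK[OF ex] zero_K by (simp add: g_def)
    assume "g w \<noteq> \<zero>\<^bsub>A\<lparr>carrier := K\<rparr>\<^esub>"
    then have nz: "w \<in> lists {1..n}" "sorted w" "f (exponents n w) \<noteq> \<zero>"
      by (auto simp: g_def split: if_splits)
    then show "w \<in> lists {1..n}" by blast
    show "w \<in> sorted_word n ` {\<alpha> \<in> multi_indices. f \<alpha> \<noteq> \<zero>}"
      using nz ex sorted_word_exponents[OF nz(2,1)] by (intro image_eqI[of _ _ "exponents n w"]) auto
  qed
  have gs: "\<forall>w. g w \<noteq> \<zero> \<longrightarrow> sorted w" by (simp add: g_def)
  have "{\<alpha> \<in> multi_indices. g (sorted_word n \<alpha>) \<noteq> \<zero>} = {\<alpha> \<in> multi_indices. f \<alpha> \<noteq> \<zero>}"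
    using g_sorted by (intro Collect_cong conj_cong refl) simp
  then have "ev g = (\<Oplus>\<alpha>\<in>{\<alpha> \<in> multi_indices. f \<alpha> \<noteq> \<zero>}. g (sorted_word n \<alpha>) \<otimes> standard_monomial A n x \<alpha>)"
    using ev_sorted(2)[OF g gs] by simp
  also have "\<dots> = a"
    unfolding f(3)
    using fK K_subset word_value_closed[OF sorted_word_lists] g_sorted
    by (intro finsum_cong' refl) (auto simp flip: word_value_sorted_word)
  finally show "a \<in> ev ` carrier free.T" using g by blast
next
  fix a assume "a \<in> ev ` carrier free.T"
  then show "a \<in> carrier A" using ev_closed by blast
qed

end

section \<open>The relations of a skew PBW extension\<close>

context free_alg begin

section \<open>Subspaces of the free algebra\<close>

lemma submodule_free_algebraI:
  assumes "H \<subseteq> carrier T" "\<zero>\<^bsub>T\<^esub> \<in> H"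
    and "\<And>f g. f \<in> H \<Longrightarrow> g \<in> H \<Longrightarrow> f \<oplus>\<^bsub>T\<^esub> g \<in> H"
    and smult: "\<And>a f. a \<in> carrier k \<Longrightarrow> f \<in> H \<Longrightarrow> a \<odot>\<^bsub>T\<^esub> f \<in> H"
  shows "submodule H k T"
proof (rule module.submoduleI[OF module_free_algebra])
  fix f assume f: "f \<in> H"
  have eq: "\<ominus>\<^bsub>T\<^esub> f = (\<ominus> \<one>) \<odot>\<^bsub>T\<^esub> f"
    using subsetD[OF assms(1) f] by (simp add: neg_eq l_minus coeff_closed)
  show "\<ominus>\<^bsub>T\<^esub> f \<in> H" unfolding eq by (rule smult[OF _ f]) simp
qed (use assms in blast)+

lemma ideal_smult:
  assumes "ideal J T" "a \<in> carrier k" "f \<in> J"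
  shows "a \<odot>\<^bsub>T\<^esub> f \<in> J"
proof -
  interpret J: ideal J T by fact
  show ?thesis
    unfolding smult_eq_mult[OF assms(2) J.Icarr[OF assms(3)]]
    using assms(2,3) by (intro J.I_l_closed) auto
qed

lemma submodule_subspace_generated:
  assumes "S \<subseteq> carrier T"
  shows "submodule (subspace_generated k T S) k T"
proof (rule submodule_free_algebraI)
  note E = module.submoduleE[OF module_free_algebra]
  \<comment> \<open>The carrier is one of the submodules containing \<open>S\<close>, so the
    intersection is not over an empty family.\<close>
  show "subspace_generated k T S \<subseteq> carrier T"
    unfolding subspace_generated_def
    using module.carrier_is_submodule[OF module_free_algebra] assms by blast
  show "\<zero>\<^bsub>T\<^esub> \<in> subspace_generated k T S"
    unfolding subspace_generated_def
    using submodule.axioms(1)[THEN subgroup.one_closed] by fastforce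
  show "f \<oplus>\<^bsub>T\<^esub> g \<in> subspace_generated k T S"
    if "f \<in> subspace_generated k T S" "g \<in> subspace_generated k T S" for f g
    using that E(5) unfolding subspace_generated_def by blast
  show "a \<odot>\<^bsub>T\<^esub> f \<in> subspace_generated k T S"
    if "a \<in> carrier k" "f \<in> subspace_generated k T S" for a f
    using that E(4) unfolding subspace_generated_def by blast
qed

lemma subspace_generated_least:
  "submodule H k T \<Longrightarrow> S \<subseteq> H \<Longrightarrow> subspace_generated k T S \<subseteq> H"
  unfolding subspace_generated_def by blast

lemma subspace_generated_superset: "S \<subseteq> subspace_generated k T S"
  unfolding subspace_generated_def by blast

lemma component_add:
  "f \<in> carrier T \<Longrightarrow> g \<in> carrier T \<Longrightarrow> homogeneous_component k d (f \<oplus>\<^bsub>T\<^esub> g) =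
    homogeneous_component k d f \<oplus>\<^bsub>T\<^esub> homogeneous_component k d g"
  by (auto simp: homogeneous_component_def)

lemma component_smult:
  "a \<in> carrier k \<Longrightarrow> homogeneous_component k d (a \<odot>\<^bsub>T\<^esub> f) = a \<odot>\<^bsub>T\<^esub> homogeneous_component k d f"
  by (auto simp: homogeneous_component_def)

lemma submodule_tensor_filtration: "submodule (tensor_filtration k I d) k T"
proof (rule submodule_free_algebraI)
  show "tensor_filtration k I d \<subseteq> carrier T" by (auto simp: tensor_filtration_def)
  show "\<zero>\<^bsub>T\<^esub> \<in> tensor_filtration k I d" using T.zero_closed by (simp add: tensor_filtration_def)
  fix f g assume fg: "f \<in> tensor_filtration k I d" "g \<in> tensor_filtration k I d"
  then have c: "f \<oplus>\<^bsub>T\<^esub> g \<in> carrier T" by (intro T.a_closed) (auto simp: tensor_filtration_def)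
  have "f w \<noteq> \<zero> \<or> g w \<noteq> \<zero>" if "(f \<oplus>\<^bsub>T\<^esub> g) w \<noteq> \<zero>" for w using that by auto
  then show "f \<oplus>\<^bsub>T\<^esub> g \<in> tensor_filtration k I d"
    using c fg unfolding tensor_filtration_def by blast
next
  fix a f assume a: "a \<in> carrier k" and f: "f \<in> tensor_filtration k I d"
  then have c: "a \<odot>\<^bsub>T\<^esub> f \<in> carrier T"
    by (intro module.smult_closed[OF module_free_algebra]) (auto simp: tensor_filtration_def)
  have "f w \<noteq> \<zero>" if "(a \<odot>\<^bsub>T\<^esub> f) w \<noteq> \<zero>" for w using that a by auto
  then show "a \<odot>\<^bsub>T\<^esub> f \<in> tensor_filtration k I d"
    using c f unfolding tensor_filtration_def by blast
qed

text \<open>A claim about the components of all elements of a generated subspace can thereby be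
  checked on generators.\<close>

lemma submodule_component_ideal:
  assumes "ideal J T"
  shows "submodule {f \<in> carrier T. homogeneous_component k d f \<in> J} k T"
proof (rule submodule_free_algebraI)
  interpret J: ideal J T by fact
  have "homogeneous_component k d \<zero>\<^bsub>T\<^esub> = \<zero>\<^bsub>T\<^esub>" by (auto simp: homogeneous_component_def)
  then show "\<zero>\<^bsub>T\<^esub> \<in> {f \<in> carrier T. homogeneous_component k d f \<in> J}"
    using T.zero_closed J.zero_closed by simp
  fix f g assume "f \<in> {f \<in> carrier T. homogeneous_component k d f \<in> J}"
    "g \<in> {f \<in> carrier T. homogeneous_component k d f \<in> J}"
  then show "f \<oplus>\<^bsub>T\<^esub> g \<in> {f \<in> carrier T. homogeneous_component k d f \<in> J}"
    using T.a_closed[of f g] J.a_closed component_add[of f g d] by (simp del: free_algebra_sel)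
next
  fix a f assume "a \<in> carrier k" "f \<in> {f \<in> carrier T. homogeneous_component k d f \<in> J}"
  then show "a \<odot>\<^bsub>T\<^esub> f \<in> {f \<in> carrier T. homogeneous_component k d f \<in> J}"
    using module.smult_closed[OF module_free_algebra] ideal_smult[OF assms] component_smult[of a d f]
    by (simp del: free_algebra_sel)
qed blast

end

text \<open>Lets the vanishing of relators pass to the subspace that they span.\<close>

lemma (in central_evaluation) submodule_ev_kernel:
  "submodule {f \<in> carrier free.T. ev f = \<zero>} (A\<lparr>carrier := K\<rparr>) free.T"
proof (rule free.submodule_free_algebraI)
  fix a f assume a: "a \<in> carrier (A\<lparr>carrier := K\<rparr>)" and f: "f \<in> {f \<in> carrier free.T. ev f = \<zero>}"
  have m: "free.monomial a [] \<in> carrier free.T" using a by simp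
  have "ev (a \<odot>\<^bsub>free.T\<^esub> f) = ev (free.monomial a []) \<otimes> ev f"
    using free.smult_eq_mult[OF a] ev_mult[OF m] f by simp
  also have "\<dots> = \<zero>" using ev_closed[OF m] f by simp
  finally show "a \<odot>\<^bsub>free.T\<^esub> f \<in> {f \<in> carrier free.T. ev f = \<zero>}"
    using module.smult_closed[OF free.module_free_algebra a] f by simp
next
  show "\<zero>\<^bsub>free.T\<^esub> \<in> {f \<in> carrier free.T. ev f = \<zero>}" using ev_zero free.T.zero_closed by blast
  fix f g assume "f \<in> {f \<in> carrier free.T. ev f = \<zero>}" "g \<in> {f \<in> carrier free.T. ev f = \<zero>}"
  then show "f \<oplus>\<^bsub>free.T\<^esub> g \<in> {f \<in> carrier free.T. ev f = \<zero>}"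
    using free.T.a_closed[of f g] ev_add[of f g] by (simp del: free.free_algebra_sel)
qed blast

context skew_extension begin

abbreviation (input) "k \<equiv> A\<lparr>carrier := K\<rparr>"

section \<open>The relators and their values\<close>

definition affine_part :: "(nat \<Rightarrow> 'a) \<Rightarrow> nat list \<Rightarrow> 'a" where
  "affine_part r = free.monomial (r 0) [] \<oplus>\<^bsub>free.T\<^esub> (\<Oplus>\<^bsub>free.T\<^esub>l\<in>{1..n}. free.monomial (r l) [l])"

lemma c_closed: "i \<in> {1..n} \<Longrightarrow> j \<in> {1..n} \<Longrightarrow> c i j \<in> K"
  using constants by (auto simp: commutation_constants_def)

lemma one_K: "\<one> \<in> K"
  using free.one_closed by simp

lemma homogeneous_relator_eq:
  assumes "i \<in> {1..n}" "j \<in> {1..n}"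
  shows "homogeneous_relator k n c i j =
    free.monomial \<one> [j, i] \<ominus>\<^bsub>free.T\<^esub> free.monomial (c i j) [i, j]"
proof -
  have one: "\<one>\<^bsub>k\<^esub> = \<one>" "\<one>\<^bsub>k\<^esub> \<in> carrier k" "c i j \<in> carrier k"
    using one_K c_closed[OF assms] by simp_all
  have l: "[i] \<in> lists {1..n}" "[j] \<in> lists {1..n}" using assms by simp_all
  have m: "\<one>\<^bsub>k\<^esub> \<otimes>\<^bsub>k\<^esub> \<one>\<^bsub>k\<^esub> = \<one>\<^bsub>k\<^esub>" "c i j \<otimes>\<^bsub>k\<^esub> \<one>\<^bsub>k\<^esub> = c i j"
    by (rule free.r_one[OF one(2)], rule free.r_one[OF one(3)])
  have "homogeneous_relator k n c i j =
      free.monomial \<one>\<^bsub>k\<^esub> [j, i] \<ominus>\<^bsub>free.T\<^esub> free.monomial (c i j) [i, j]"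
    unfolding homogeneous_relator_def Let_def free.free_var_eq
      free.mult_monom_monom[OF one(2,2) l(2,1)] free.mult_monom_monom[OF one(2,2) l] m
      free.smult_monom[OF one(3,2)] append.simps ..
  then show ?thesis unfolding one(1) .
qed

lemma homogeneous_relator_closed:
  assumes "i \<in> {1..n}" "j \<in> {1..n}"
  shows "homogeneous_relator k n c i j \<in> carrier free.T"
  unfolding homogeneous_relator_eq[OF assms]
  using assms one_K c_closed[OF assms] by (intro free.T.minus_closed free.monom_carrier) simp_all

lemma homogeneous_relator_coeff:
  assumes "i \<in> {1..n}" "j \<in> {1..n}" "length w \<noteq> 2"
  shows "homogeneous_relator k n c i j w = \<zero>"
proof -
  have m: "free.monomial \<one> [j, i] \<in> carrier free.T" "free.monomial (c i j) [i, j] \<in> carrier free.T"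
    using assms one_K c_closed[OF assms(1,2)] by (intro free.monom_carrier; simp)+
  have "free.monomial \<one> [j, i] w = \<zero>\<^bsub>k\<^esub>" "free.monomial (c i j) [i, j] w = \<zero>\<^bsub>k\<^esub>"
    using assms(3) by (auto simp: free.monomial_def)
  moreover have "\<zero>\<^bsub>k\<^esub> \<ominus>\<^bsub>k\<^esub> \<zero>\<^bsub>k\<^esub> = \<zero>\<^bsub>k\<^esub>"
    using free.r_right_minus_eq[OF free.zero_closed free.zero_closed] by blast
  ultimately have "(free.monomial \<one> [j, i] \<ominus>\<^bsub>free.T\<^esub> free.monomial (c i j) [i, j]) w = \<zero>\<^bsub>k\<^esub>"
    unfolding free.diff_eq[OF m] by presburger
  then show ?thesis
    unfolding homogeneous_relator_eq[OF assms(1,2)] by simp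
qed

lemma coeff_r: "r \<in> {0..n} \<rightarrow> K \<Longrightarrow> l \<le> n \<Longrightarrow> r l \<in> K"
  using Pi_mem[of r "{0..n}" "\<lambda>_. K" l] by simp

lemma affine_part_terms:
  assumes "r \<in> {0..n} \<rightarrow> K"
  shows "free.monomial (r 0) [] \<in> carrier free.T"
    and "(\<lambda>l. free.monomial (r l) [l]) \<in> {1..n} \<rightarrow> carrier free.T"
  using coeff_r[OF assms] by (intro Pi_I free.monom_carrier; simp)+

lemma affine_part_closed: "r \<in> {0..n} \<rightarrow> K \<Longrightarrow> affine_part r \<in> carrier free.T"
  unfolding affine_part_def by (intro free.T.a_closed free.T.finsum_closed affine_part_terms)

lemma affine_part_coeff:
  assumes "r \<in> {0..n} \<rightarrow> K" "length w \<ge> 2"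
  shows "affine_part r w = \<zero>"
proof -
  have "(\<Oplus>\<^bsub>free.T\<^esub>l\<in>{1..n}. free.monomial (r l) [l]) w = (\<Oplus>\<^bsub>k\<^esub>l\<in>{1..n}. free.monomial (r l) [l] w)"
    by (rule free.finsum_coeff[OF affine_part_terms(2)[OF assms(1)]])
  also have "\<dots> = \<zero>\<^bsub>k\<^esub>"
    using assms(2) by (intro free.add.finprod_one_eqI) (auto simp: free.monomial_def)
  finally show ?thesis
    unfolding affine_part_def free.free_algebra_sel using assms(2) by (auto simp: free.monomial_def)
qed

lemma relator_eq:
  assumes "i \<in> {1..n}" "j \<in> {1..n}" "r \<in> {0..n} \<rightarrow> K"
  shows "relator k n c i j r = homogeneous_relator k n c i j \<oplus>\<^bsub>free.T\<^esub> affine_part r"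
proof -
  have r: "r l \<in> K" if "l \<le> n" for l using coeff_r[OF assms(3) that] .
  have "r 0 \<odot>\<^bsub>free.T\<^esub> \<one>\<^bsub>free.T\<^esub> = free.monomial (r 0) []"
    unfolding free.one_eq using free.smult_monom[of "r 0" \<one>] r[of 0] one_K K_subset by auto
  moreover have "(\<Oplus>\<^bsub>free.T\<^esub>l\<in>{1..n}. r l \<odot>\<^bsub>free.T\<^esub> free_var k l) =
      (\<Oplus>\<^bsub>free.T\<^esub>l\<in>{1..n}. free.monomial (r l) [l])"
  proof (rule free.T.finsum_cong'[OF refl affine_part_terms(2)[OF assms(3)]])
    fix l assume "l \<in> {1..n}"
    then have "r l \<in> K" using r by simp
    then show "r l \<odot>\<^bsub>free.T\<^esub> free_var k l = free.monomial (r l) [l]"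
      unfolding free.free_var_eq using free.smult_monom[of "r l" \<one>] one_K K_subset by auto
  qed
  ultimately show ?thesis
    unfolding relator_def Let_def affine_part_def
    using homogeneous_relator_closed[OF assms(1,2)] affine_part_terms[OF assms(3)]
    by (simp add: free.T.a_assoc free.T.finsum_closed del: free.free_algebra_sel One_nat_def)
qed

lemma relator_closed:
  assumes "i \<in> {1..n}" "j \<in> {1..n}" "r \<in> {0..n} \<rightarrow> K"
  shows "relator k n c i j r \<in> carrier free.T"
  unfolding relator_eq[OF assms]
  using assms by (intro free.T.a_closed homogeneous_relator_closed affine_part_closed)

lemma relator_filtration:
  assumes "i \<in> {1..n}" "j \<in> {1..n}" "r \<in> {0..n} \<rightarrow> K"
  shows "relator k n c i j r \<in> tensor_filtration k {1..n} 2"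
proof -
  have "relator k n c i j r w = \<zero>" if "2 < length w" for w
    unfolding relator_eq[OF assms] free.free_algebra_sel
    using homogeneous_relator_coeff[OF assms(1,2), of w] affine_part_coeff[OF assms(3), of w] that by simp
  then show ?thesis
    using relator_closed[OF assms] unfolding tensor_filtration_def by (auto simp flip: not_less)
qed

lemma component_relator:
  assumes "i \<in> {1..n}" "j \<in> {1..n}" "r \<in> {0..n} \<rightarrow> K"
  shows "homogeneous_component k 2 (relator k n c i j r) = homogeneous_relator k n c i j"
proof
  fix w
  have "homogeneous_relator k n c i j w \<in> carrier A"
    by (rule coeff_A[OF homogeneous_relator_closed[OF assms(1,2)]])
  then show "homogeneous_component k 2 (relator k n c i j r) w = homogeneous_relator k n c i j w"
    unfolding homogeneous_component_def relator_eq[OF assms] free.free_algebra_sel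
    using homogeneous_relator_coeff[OF assms(1,2), of w] affine_part_coeff[OF assms(3), of w] by auto
qed

lemma ev_affine_part:
  assumes "r \<in> {0..n} \<rightarrow> K"
  shows "ev (affine_part r) = r 0 \<oplus> (\<Oplus>l\<in>{1..n}. r l \<otimes> x l)"
proof -
  have r: "r l \<in> K" if "l \<le> n" for l using coeff_r[OF assms that] .
  have "ev (\<Oplus>\<^bsub>free.T\<^esub>l\<in>{1..n}. free.monomial (r l) [l]) = (\<Oplus>l\<in>{1..n}. ev (free.monomial (r l) [l]))"
    using ring_hom_ring.hom_finsum[OF ev_hom affine_part_terms(2)[OF assms]] by (simp add: comp_def)
  also have "\<dots> = (\<Oplus>l\<in>{1..n}. r l \<otimes> x l)"
  proof (rule finsum_cong'[OF refl])
    show "(\<lambda>l. r l \<otimes> x l) \<in> {1..n} \<rightarrow> carrier A"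
      using r K_subset x_closed by (intro Pi_I m_closed) auto
    fix l assume l: "l \<in> {1..n}"
    then show "ev (free.monomial (r l) [l]) = r l \<otimes> x l"
      using r[of l] x_closed[OF l] by (subst ev_monom) auto
  qed
  finally show ?thesis
    unfolding affine_part_def ev_add[OF affine_part_terms(1)[OF assms] free.T.finsum_closed[OF affine_part_terms(2)[OF assms]]]
    using ev_monom[of "r 0" "[]"] r[of 0] K_subset by auto
qed

lemma ev_homogeneous_relator:
  assumes "i \<in> {1..n}" "j \<in> {1..n}"
  shows "ev (homogeneous_relator k n c i j) = x j \<otimes> x i \<ominus> c i j \<otimes> (x i \<otimes> x j)"
proof -
  interpret ev: ring_hom_ring free.T A ev by (rule ev_hom)
  have m: "free.monomial \<one> [j, i] \<in> carrier free.T" "free.monomial (c i j) [i, j] \<in> carrier free.T"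
    using assms one_K c_closed[OF assms] by (intro free.monom_carrier; simp)+
  have v: "word_value [j, i] = x j \<otimes> x i" "word_value [i, j] = x i \<otimes> x j"
    using assms x_closed by (auto simp del: atLeastAtMost_iff)
  have l: "[j, i] \<in> lists {1..n}" "[i, j] \<in> lists {1..n}" using assms by simp_all
  have "ev (homogeneous_relator k n c i j) = ev (free.monomial \<one> [j, i]) \<ominus> ev (free.monomial (c i j) [i, j])"
    unfolding homogeneous_relator_eq[OF assms] a_minus_def
    using m by (simp del: free.free_algebra_sel One_nat_def)
  also have "\<dots> = x j \<otimes> x i \<ominus> c i j \<otimes> (x i \<otimes> x j)"
    unfolding ev_monom[OF one_K l(1)] ev_monom[OF c_closed[OF assms] l(2)] v
    using assms x_closed by simp
  finally show ?thesis .
qed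

text \<open>\<open>P\<close> is spanned by those relators that vanish in \<open>A\<close>; a pair
  with no vanishing relator would contribute nothing to the homogeneous relations. The defining
  condition on \<open>c i j\<close> rules this out.\<close>

lemma exists_relator:
  assumes "i \<in> {1..n}" "j \<in> {1..n}"
  shows "\<exists>r\<in>{0..n} \<rightarrow> K. ev (relator k n c i j r) = \<zero>"
proof -
  have "x j \<otimes> x i \<ominus> c i j \<otimes> (x i \<otimes> x j) \<in> linear_part A K n x"
    using constants assms unfolding commutation_constants_def by blast
  then obtain r where r: "r \<in> {0..n} \<rightarrow> K"
    "x j \<otimes> x i \<ominus> c i j \<otimes> (x i \<otimes> x j) = r 0 \<oplus> (\<Oplus>l\<in>{1..n}. r l \<otimes> x l)"
    unfolding linear_part_def by blast
  have ev_r: "ev (homogeneous_relator k n c i j) = ev (affine_part r)"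
    unfolding ev_homogeneous_relator[OF assms] ev_affine_part[OF r(1)] by (rule r(2))
  \<comment> \<open>\<open>linear_part\<close> yields the value of the quadratic part, whereas a
    relator adds its affine part; hence the sign.\<close>
  let ?r = "\<lambda>l. \<ominus>\<^bsub>k\<^esub> r l"
  have neg: "?r \<in> {0..n} \<rightarrow> K" using r(1) free.a_inv_closed by (fastforce simp: Pi_iff)
  \<comment> \<open>Negation selects an inverse inside the carrier, so the negatives in
    \<open>K\<close> and in \<open>A\<close> have to be identified.\<close>
  have negA: "\<ominus>\<^bsub>k\<^esub> a = \<ominus> a" if "a \<in> K" for a
    using that K_subset free.l_neg[of a] free.a_inv_closed[of a]
    by (intro minus_equality[symmetric]) auto
  have rA: "r l \<in> carrier A" "x l \<in> carrier A" if "l \<in> {1..n}" for l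
    using coeff_r[OF r(1), of l] that K_subset x_closed by auto
  have "ev (affine_part ?r) = \<ominus> r 0 \<oplus> (\<Oplus>l\<in>{1..n}. \<ominus> \<one> \<otimes> (r l \<otimes> x l))"
    unfolding ev_affine_part[OF neg]
  proof (rule arg_cong2[where f = "(\<oplus>)"])
    show "\<ominus>\<^bsub>k\<^esub> r 0 = \<ominus> r 0" using coeff_r[OF r(1)] by (intro negA) simp
    show "(\<Oplus>l\<in>{1..n}. \<ominus>\<^bsub>k\<^esub> r l \<otimes> x l) = (\<Oplus>l\<in>{1..n}. \<ominus> \<one> \<otimes> (r l \<otimes> x l))"
    proof (rule finsum_cong'[OF refl])
      fix l assume l: "l \<in> {1..n}"
      then have "r l \<in> K" using coeff_r[OF r(1)] by simp
      then show "\<ominus>\<^bsub>k\<^esub> r l \<otimes> x l = \<ominus> \<one> \<otimes> (r l \<otimes> x l)"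
        using rA[OF l] by (simp add: negA l_minus)
    qed (use rA in blast)
  qed
  also have "(\<Oplus>l\<in>{1..n}. \<ominus> \<one> \<otimes> (r l \<otimes> x l)) = \<ominus> \<one> \<otimes> (\<Oplus>l\<in>{1..n}. r l \<otimes> x l)"
    using rA by (intro finsum_rdistr[symmetric]) auto
  also have "\<ominus> r 0 \<oplus> \<dots> = \<ominus> ev (affine_part r)"
  proof -
    have "r 0 \<in> carrier A" using coeff_r[OF r(1), of 0] K_subset by blast
    moreover have "(\<Oplus>l\<in>{1..n}. r l \<otimes> x l) \<in> carrier A" using rA by (intro finsum_closed Pi_I m_closed)
    ultimately show ?thesis unfolding ev_affine_part[OF r(1)]
      by (simp add: l_minus minus_add del: One_nat_def)
  qed
  finally have "ev (affine_part ?r) = \<ominus> ev (homogeneous_relator k n c i j)" unfolding ev_r .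
  then have "ev (relator k n c i j ?r) = \<zero>"
    unfolding relator_eq[OF assms neg] ev_add[OF homogeneous_relator_closed[OF assms] affine_part_closed[OF neg]]
    using r_neg[OF ev_closed[OF homogeneous_relator_closed[OF assms]]] by simp
  then show ?thesis using neg by blast
qed

section \<open>The relation space and the ideals it determines\<close>

definition vanishing_relators :: "(nat list \<Rightarrow> 'a) set" where
  "vanishing_relators = {relator k n c i j r | i j r. i \<in> {1..n} \<and> j \<in> {1..n} \<and>
     r \<in> {0..n} \<rightarrow> K \<and> ev (relator k n c i j r) = \<zero>}"

definition homogeneous_relators :: "(nat list \<Rightarrow> 'a) set" where
  "homogeneous_relators = {homogeneous_relator k n c i j | i j. i \<in> {1..n} \<and> j \<in> {1..n}}"

abbreviation "P \<equiv> relation_space A K n x c"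

lemma relation_space_eq: "P = subspace_generated k free.T vanishing_relators"
  by (simp add: relation_space_def vanishing_relators_def Let_def)

lemma vanishing_relators_closed: "vanishing_relators \<subseteq> carrier free.T"
  unfolding vanishing_relators_def using relator_closed by blast

lemma submodule_relation_space: "submodule P k free.T"
  unfolding relation_space_eq by (rule free.submodule_subspace_generated[OF vanishing_relators_closed])

lemma relation_space_filtration: "P \<subseteq> tensor_filtration k {1..n} 2"
  unfolding relation_space_eq
proof (rule free.subspace_generated_least[OF free.submodule_tensor_filtration])
  show "vanishing_relators \<subseteq> tensor_filtration k {1..n} 2"
    unfolding vanishing_relators_def using relator_filtration by blast
qed

lemma relation_space_closed: "P \<subseteq> carrier free.T"
  using relation_space_filtration unfolding tensor_filtration_def by blast

lemma ev_relation_space: "P \<subseteq> {f \<in> carrier free.T. ev f = \<zero>}"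
  unfolding relation_space_eq
proof (rule free.subspace_generated_least[OF submodule_ev_kernel])
  show "vanishing_relators \<subseteq> {f \<in> carrier free.T. ev f = \<zero>}"
    unfolding vanishing_relators_def using relator_closed by blast
qed

lemma homogeneous_relators_closed: "homogeneous_relators \<subseteq> carrier free.T"
  unfolding homogeneous_relators_def using homogeneous_relator_closed by blast

text \<open>The quadratic parts of \<open>P\<close> include linear combinations of the homogeneous
  relators, so the ideals are compared rather than the generating sets. For one inclusion membership
  passes to linear combinations; for the other \<open>exists_relator\<close> realizes each
  homogeneous relator as a quadratic part.\<close>

lemma homogeneous_ideal_eq:
  "genideal free.T (homogeneous_component k 2 ` P) = genideal free.T homogeneous_relators"
proof (rule equalityI)
  let ?J = "genideal free.T homogeneous_relators"
  have J: "ideal ?J free.T" by (rule free.T.genideal_ideal[OF homogeneous_relators_closed])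
  have sub: "homogeneous_relators \<subseteq> ?J" by (rule free.T.genideal_self[OF homogeneous_relators_closed])
  have "P \<subseteq> {f \<in> carrier free.T. homogeneous_component k 2 f \<in> ?J}"
    unfolding relation_space_eq
  proof (rule free.subspace_generated_least[OF free.submodule_component_ideal[OF J]], rule subsetI)
    fix f assume "f \<in> vanishing_relators"
    then obtain i j r where f: "f = relator k n c i j r"
      and ijr: "i \<in> {1..n}" "j \<in> {1..n}" "r \<in> {0..n} \<rightarrow> K"
      unfolding vanishing_relators_def by blast
    have "homogeneous_relator k n c i j \<in> ?J"
      using sub ijr unfolding homogeneous_relators_def by blast
    then show "f \<in> {f \<in> carrier free.T. homogeneous_component k 2 f \<in> ?J}"
      unfolding f using component_relator[OF ijr] relator_closed[OF ijr] by simp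
  qed
  then show "genideal free.T (homogeneous_component k 2 ` P) \<subseteq> ?J"
    by (intro free.T.genideal_minimal[OF J]) blast
next
  have "homogeneous_relators \<subseteq> homogeneous_component k 2 ` P"
  proof
    fix f assume "f \<in> homogeneous_relators"
    then obtain i j where f: "f = homogeneous_relator k n c i j"
      and ij: "i \<in> {1..n}" "j \<in> {1..n}"
      unfolding homogeneous_relators_def by blast
    obtain r where r: "r \<in> {0..n} \<rightarrow> K" "ev (relator k n c i j r) = \<zero>"
      using exists_relator[OF ij] by blast
    then have "relator k n c i j r \<in> P"
      using ij free.subspace_generated_superset[of vanishing_relators]
      unfolding relation_space_eq vanishing_relators_def by blast
    then show "f \<in> homogeneous_component k 2 ` P"
      unfolding f component_relator[OF ij r(1), symmetric] by blast
  qed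
  moreover have "homogeneous_component k 2 ` P \<subseteq> carrier free.T"
    using free.component_carrier relation_space_closed by blast
  ultimately show "genideal free.T homogeneous_relators \<subseteq> genideal free.T (homogeneous_component k 2 ` P)"
    using free.T.genideal_self
    by (intro free.T.genideal_minimal free.T.genideal_ideal) blast+
qed

text \<open>Sorting takes place modulo the homogeneous ideal, where a swap leaves no lower terms;
  the relator of a pair \<open>i < j\<close> is itself the swap, with constant
  \<open>c i j\<close>.\<close>

sublocale straightening k "{1..n}" "genideal free.T homogeneous_relators"
proof (rule straightening.intro[OF free.free_alg_axioms], rule straightening_axioms.intro)
  show "ideal (genideal free.T homogeneous_relators) free.T"
    by (rule free.T.genideal_ideal[OF homogeneous_relators_closed])
  fix i j assume ij: "i \<in> {1..n}" "j \<in> {1..n}" "i < j"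
  have "homogeneous_relator k n c i j \<in> genideal free.T homogeneous_relators"
    using free.T.genideal_self[OF homogeneous_relators_closed] ij
    unfolding homogeneous_relators_def by blast
  then show "\<exists>s\<in>carrier k. free.monomial \<one>\<^bsub>k\<^esub> [j, i] \<ominus>\<^bsub>free.T\<^esub> free.monomial s [i, j]
      \<in> genideal free.T homogeneous_relators"
    unfolding homogeneous_relator_eq[OF ij(1,2)] using c_closed[OF ij(1,2)] by auto
qed

lemma relation_ideal: "ideal (genideal free.T P) free.T"
  by (rule free.T.genideal_ideal[OF relation_space_closed])

lemma homogeneous_ideal_leading:
  "genideal free.T homogeneous_relators \<subseteq> free.leading_ideal (genideal free.T P)"
  using free.genideal_components_leading[OF relation_space_filtration]
  unfolding homogeneous_ideal_eq .

text \<open>An element of the kernel is congruent to a sorted polynomial, whose value is then zero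
  as well because relators vanish; independence makes that polynomial zero.\<close>

lemma relation_ideal_kernel: "genideal free.T P = a_kernel free.T A ev"
proof (rule equalityI)
  interpret ev: ring_hom_ring free.T A ev by (rule ev_hom)
  interpret N: ideal "genideal free.T P" free.T by (rule relation_ideal)
  have kernel: "a_kernel free.T A ev = {f \<in> carrier free.T. ev f = \<zero>}"
    by (rule a_kernel_def')
  show sub: "genideal free.T P \<subseteq> a_kernel free.T A ev"
    by (rule free.T.genideal_minimal[OF ev.kernel_is_ideal])
      (unfold kernel, rule ev_relation_space)
  show "a_kernel free.T A ev \<subseteq> genideal free.T P"
  proof
    fix f assume "f \<in> a_kernel free.T A ev"
    then have f: "f \<in> carrier free.T" "ev f = \<zero>" unfolding kernel by blast+
    obtain d where d: "\<And>w. f w \<noteq> \<zero>\<^bsub>k\<^esub> \<Longrightarrow> length w < d"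
      using free.exists_length_bound[OF f(1)] by metis
    obtain g where g: "g \<in> sorted_below d" "f \<ominus>\<^bsub>free.T\<^esub> g \<in> genideal free.T P"
      using straighten_lower[OF relation_ideal homogeneous_ideal_leading f(1) d] by blast
    have gT: "g \<in> carrier free.T" and sorted: "\<forall>w. g w \<noteq> \<zero> \<longrightarrow> sorted w"
      using g(1) unfolding sorted_below_def by simp_all
    have "f \<ominus>\<^bsub>free.T\<^esub> g \<in> a_kernel free.T A ev" using sub g(2) by blast
    then have "ev f \<ominus> ev g = \<zero>"
      unfolding kernel a_minus_def using f(1) gT by (simp del: free.free_algebra_sel One_nat_def)
    then have "ev g = \<zero>"
      using f(2) ev_closed[OF gT] by (metis r_right_minus_eq zero_closed)
    then have "g = \<zero>\<^bsub>free.T\<^esub>" by (rule sorted_independent[OF gT sorted])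
    then show "f \<in> genideal free.T P"
      using g(2) f(1) free.T.minus_zero free.T.r_zero unfolding a_minus_def by metis
  qed
qed

lemma presentation: "presented_by A K {1..n} x P"
proof -
  let ?h = "\<lambda>X. the_elem (ev ` X)"
  interpret ev: ring_hom_ring free.T A ev by (rule ev_hom)
  have iso: "?h \<in> ring_iso (quadratic_algebra k {1..n} P) A"
    using ev.FactRing_iso_set[OF ev_surj]
    unfolding quadratic_algebra_def relation_ideal_kernel .
  \<comment> \<open>\<open>the_elem\<close> is meaningful only on singletons, so \<open>ev\<close>
    is first shown to be constant on the class of \<open>f\<close>.\<close>
  have val: "?h (quotient_class k {1..n} P f) = ev f" if f: "f \<in> carrier free.T" for f
  proof -
    interpret N: ideal "genideal free.T P" free.T by (rule relation_ideal)
    have val_eq: "ev y = ev f" if "y \<in> quotient_class k {1..n} P f" for y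
    proof -
      have "y \<in> (\<Union>z\<in>genideal free.T P. {z \<oplus>\<^bsub>free.T\<^esub> f})"
        using that unfolding quotient_class_def a_r_coset_def' .
      then obtain z where z: "z \<in> genideal free.T P" "y = z \<oplus>\<^bsub>free.T\<^esub> f" by blast
      have "z \<in> carrier free.T" "ev z = \<zero>"
        using z(1) unfolding relation_ideal_kernel a_kernel_def' by blast+
      show ?thesis
        unfolding z(2) ev_add[OF \<open>z \<in> carrier free.T\<close> f] \<open>ev z = \<zero>\<close>
        by (rule l_zero[OF ev_closed[OF f]])
    qed
    have "f \<in> quotient_class k {1..n} P f"
      unfolding quotient_class_def by (rule N.a_rcos_self[OF f])
    then have "{ev f} \<subseteq> ev ` quotient_class k {1..n} P f" by blast
    moreover have "ev ` quotient_class k {1..n} P f \<subseteq> {ev f}"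
      by (intro image_subsetI singleton_iff[THEN iffD2] val_eq)
    ultimately have "ev ` quotient_class k {1..n} P f = {ev f}" by (rule equalityI[rotated])
    then show ?thesis by (simp only: the_elem_eq)
  qed
  have scalars: "?h (quotient_class k {1..n} P (r \<odot>\<^bsub>free.T\<^esub> \<one>\<^bsub>free.T\<^esub>)) = r" if r: "r \<in> K" for r
  proof -
    have rA: "r \<in> carrier A" using r K_subset by blast
    have eq: "r \<odot>\<^bsub>free.T\<^esub> \<one>\<^bsub>free.T\<^esub> = free.monomial r []"
      unfolding free.one_eq using free.smult_monom[of r \<one> "[]"] r rA one_K by simp
    have "free.monomial r [] \<in> carrier free.T" using r by (intro free.monom_carrier) simp_all
    then have "?h (quotient_class k {1..n} P (r \<odot>\<^bsub>free.T\<^esub> \<one>\<^bsub>free.T\<^esub>)) = ev (free.monomial r [])"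
      unfolding eq by (rule val)
    also have "\<dots> = r" using ev_monom[OF r, of "[]"] rA by simp
    finally show ?thesis .
  qed
  have vars: "?h (quotient_class k {1..n} P (free_var k i)) = x i" if i: "i \<in> {1..n}" for i
  proof -
    have i': "free.monomial \<one> [i] \<in> carrier free.T" "[i] \<in> lists {1..n}"
      using i one_K by (auto intro!: free.monom_carrier simp del: One_nat_def)
    have free_var: "free_var k i = free.monomial \<one> [i]" unfolding free.free_var_eq by simp
    have "?h (quotient_class k {1..n} P (free_var k i)) = ev (free.monomial \<one> [i])"
      unfolding free_var by (rule val[OF i'(1)])
    also have "\<dots> = x i" unfolding ev_monom[OF one_K i'(2)] using x_closed[OF i] by simp
    finally show ?thesis .
  qed
  show ?thesis
    unfolding presented_by_def Let_def
    by (intro bexI[OF _ iso] conjI ballI scalars vars)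
qed

lemma homogeneous_version_eq:
  "homogeneous_version k {1..n} P = quadratic_algebra k {1..n} homogeneous_relators"
  unfolding homogeneous_version_def quadratic_algebra_def homogeneous_ideal_eq ..

lemma PBW_relation_space: "PBW_deformation k {1..n} P"
proof (rule free.PBW_deformationI[OF submodule_relation_space relation_space_filtration])
  show "free.leading_ideal (genideal free.T P) \<subseteq> genideal free.T (homogeneous_component k 2 ` P)"
    unfolding homogeneous_ideal_eq
  proof (rule leading_ideal_subset[OF relation_ideal homogeneous_ideal_leading])
    fix g d assume g: "g \<in> sorted_below d" "g \<in> genideal free.T P"
    \<comment> \<open>The ideal being the kernel of evaluation, membership becomes the vanishing of
      the value, to which independence applies.\<close>
    then have "g \<in> carrier free.T" "ev g = \<zero>"
      unfolding relation_ideal_kernel a_kernel_def' by blast+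
    moreover have "\<forall>w. g w \<noteq> \<zero> \<longrightarrow> sorted w" using g(1) unfolding sorted_below_def by simp
    ultimately show "g = \<zero>\<^bsub>free.T\<^esub>" by (intro sorted_independent)
  qed
qed

end

theorem proposition4p5:
  fixes A :: "('a, 'm) ring_scheme" and K :: "'a set" and n :: nat
    and x :: "nat \<Rightarrow> 'a" and c :: "nat \<Rightarrow> nat \<Rightarrow> 'a"
  assumes "skew_PBW_extension A K n x"
    and "constant_extension A K n x"
    and "commutation_constants A K n x c"
  shows "let k = A\<lparr>carrier := K\<rparr>; P = relation_space A K n x c in
    presented_by A K {1..n} x P \<and>
    homogeneous_version k {1..n} P =
      quadratic_algebra k {1..n}
        {homogeneous_relator k n c i j | i j. i \<in> {1..n} \<and> j \<in> {1..n}} \<and>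
    PBW_deformation k {1..n} P"
proof -
  interpret skew_extension A K n x c
    by (rule skew_extension.intro[OF assms])
  show ?thesis
    unfolding Let_def
    using presentation homogeneous_version_eq[unfolded homogeneous_relators_def] PBW_relation_space
    by blast
qed

end
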